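(* Let $\mathcal{S}^n$ be the space of $n\times n$ real symmetric matrices, $\mathcal{S}^n_+$ the cone of positive semidefinite matrices, $\mathcal{N}^n\subseteq\mathcal{S}^n$ the cone of symmetric matrices with nonnegative entries and $\mathcal{D}^n=\mathcal{S}^n_+\cap\mathcal{N}^n$ the doubly nonnegative cone. Let $\mathcal{L}\subseteq\mathcal{S}^n$ be a subspace and $a\in\mathcal{S}^n$ such that $\mathcal{D}^n\cap(\mathcal{L}+a)\ne\emptyset$. Let $\hat{\mathcal{L}}\subseteq\mathcal{S}^n\times\mathcal{S}^n$ be a subspace and $\hat a\in\mathcal{S}^n\times\mathcal{S}^n$ such that $\hat{\mathcal{L}}+\hat a=\{(x,x):x\in\mathcal{L}+a\}$. Then there is a positive constant $\kappa$ (depending on $n,\mathcal{L},a$) such that whenever $x\in\mathcal{S}^n$ and $\epsilon$ satisfy $$\operatorname{dist}(x,\mathcal{D}^n)\le\epsilon,\qquad\operatorname{dist}(x,\mathcal{L}+a)\le\epsilon,$$ we have $$\operatorname{dist}\bigl(x,(\mathcal{L}+a)\cap\mathcal{D}^n\bigr)\le(\kappa\|x\|+\kappa)\left(\sum_{j=0}^{d_{\mathrm{PPS}}(\hat{\mathcal{L}},\hat a)}\epsilon^{(2^{-j})}\|x\|^{1-2^{-j}}\right).$$ Furthermore, $$d_{\mathrm{PPS}}(\hat{\mathcal{L}},\hat a)\le\min\{n-1,\ \dim(\hat{\mathcal{L}}^\perp\cap\{\hat a\}^\perp),\ d_{\mathrm{S}}(\hat{\mathcal{L}},\hat a)\}.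$$
   Context: $\mathcal{S}^n$ carries the inner product $\langle x,y\rangle=\operatorname{tr}(xy)$ and the induced norm; $\mathcal{S}^n\times\mathcal{S}^n$ carries the sum inner product; $\operatorname{dist}(x,C)=\inf\{\|x-y\|: y\in C\}$. The $j=0$ term of the sum is $\epsilon$. A face of a convex cone $\mathcal{K}$ is a convex cone $\mathcal{F}\subseteq\mathcal{K}$ such that $x,y\in\mathcal{K}$, $x+y\in\mathcal{F}$ imply $x,y\in\mathcal{F}$. $C^*=\{x:\langle x,y\rangle\ge0\ \forall y\in C\}$, $C^\perp$ is the orthogonal complement, $\operatorname{ri}$ the relative interior. PPS (partial polyhedral Slater) condition: for a closed convex cone $\mathcal{C}$ in a finite-dimensional inner product space $\mathcal{V}$, a subspace $\mathcal{M}\subseteq\mathcal{V}$ and $b\in\mathcal{V}$, $(\mathcal{C},\mathcal{M},b)$ satisfies the PPS condition if $\mathcal{V}$ can be written as an orthogonal product $\mathcal{V}=\mathcal{V}^1\times\mathcal{V}^2$ (a factor may be $\{0\}$) with $\mathcal{C}=\mathcal{C}^1\times\mathcal{C}^2$, where $\mathcal{C}^i\subseteq\mathcal{V}^i$ are closed convex cones, $\mathcal{C}^2$ is polyhedral, and there is $(x_1,x_2)\in\mathcal{M}+b$ with $x_1\in\operatorname{ri}\mathcal{C}^1$, $x_2\in\mathcal{C}^2$. (So it holds if $(\operatorname{ri}\mathcal{C})\cap(\mathcal{M}+b)\ne\emptyset$, or if $\mathcal{C}$ is polyhedral and $\mathcal{C}\cap(\mathcal{M}+b)\neq\emptyset$.)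 For the problem $(\mathcal{S}^n_+\times\mathcal{N}^n,\hat{\mathcal{L}},\hat a)$ consider sequences $\mathcal{F}_1=\mathcal{S}^n_+\times\mathcal{N}^n$, $z_i\in\mathcal{F}_i^*\cap\hat{\mathcal{L}}^\perp\cap\{\hat a\}^\perp$, $\mathcal{F}_{i+1}=\mathcal{F}_i\cap\{z_i\}^\perp$, $i=1,\dots,k$. $d_{\mathrm{PPS}}(\hat{\mathcal{L}},\hat a)$ is the minimum $k\ge0$ for which such a sequence exists with $(\mathcal{F}_{k+1},\hat{\mathcal{L}},\hat a)$ satisfying the PPS condition; $d_{\mathrm{S}}(\hat{\mathcal{L}},\hat a)$ (singularity degree) is the minimum $k\geq 0$ for which such a sequence exists with $\mathcal{F}_{k+1}$ equal to the minimal face of $\mathcal{S}^n_+\times\mathcal{N}^n$ containing $(\mathcal{S}^n_+\times\mathcal{N}^n)\cap(\hat{\mathcal{L}}+\hat a)$ (equivalently, $(\operatorname{ri}\mathcal{F}_{k+1})\cap(\hat{\mathcal{L}}+\hat a)\ne\emptyset$). *)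

theory Defs
  imports "HOL-Analysis.Analysis"
begin

section \<open>Cones in a finite-dimensional inner product space\<close>

text \<open>
  The inner product space under consideration is given by a carrier \<open>V\<close>, a subspace of some
  type of class \<open>euclidean_space\<close> with the inherited inner product. Dual cones and
  orthogonal complements are formed inside \<open>V\<close>.
\<close>

definition dual_cone :: "'a::euclidean_space set \<Rightarrow> 'a set \<Rightarrow> 'a set" where
  "dual_cone V C = {x \<in> V. \<forall>y\<in>C. 0 \<le> x \<bullet> y}"

definition orth_compl :: "'a::euclidean_space set \<Rightarrow> 'a set \<Rightarrow> 'a set" where
  "orth_compl V C = V \<inter> C\<^sup>\<bottom>"

text \<open>
  This is not the library's \<open>face_of\<close>, which concerns convex sets, allows the empty set, and is
  stated by open segments.
\<close>

definition cone_face :: "'a::euclidean_space set \<Rightarrow> 'a set \<Rightarrow> bool" where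
  "cone_face F K \<longleftrightarrow> convex_cone F \<and> F \<subseteq> K \<and>
     (\<forall>x\<in>K. \<forall>y\<in>K. x + y \<in> F \<longrightarrow> x \<in> F \<and> y \<in> F)"

definition minimal_face :: "'a::euclidean_space set \<Rightarrow> 'a set \<Rightarrow> 'a set" where
  "minimal_face K S = \<Inter>{F. cone_face F K \<and> S \<subseteq> F}"

text \<open>
  The partial polyhedral Slater condition. The orthogonal product \<open>V = V1 \<times> V2\<close> is an internal
  one: \<open>V\<close> is the sum of orthogonal subspaces \<open>V1\<close> and \<open>V2\<close>, the pair \<open>(x1, x2)\<close> is
  \<open>x1 + x2\<close>, and \<open>C1 \<times> C2\<close> is the sum of sets \<open>C1 + C2\<close>.
\<close>

definition PPS :: "'a::euclidean_space set \<Rightarrow> 'a set \<Rightarrow> 'a set \<Rightarrow> 'a \<Rightarrow> bool" where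
  "PPS V C M b \<longleftrightarrow>
     (\<exists>V1 V2 C1 C2.
        subspace V1 \<and> subspace V2 \<and> (\<forall>u\<in>V1. \<forall>v\<in>V2. orthogonal u v) \<and> V = V1 + V2 \<and>
        C1 \<subseteq> V1 \<and> convex_cone C1 \<and> closed C1 \<and>
        C2 \<subseteq> V2 \<and> convex_cone C2 \<and> closed C2 \<and> polyhedron C2 \<and>
        C = C1 + C2 \<and>
        (\<exists>x1\<in>rel_interior C1. \<exists>x2\<in>C2. x1 + x2 \<in> (+) b ` M))"

section \<open>Facial reduction\<close>

text \<open>
  Indices start at 0: \<open>reduced_cone K z i\<close> is the cone obtained from \<open>K\<close> after \<open>i\<close> reduction
  steps, the one usually written with index \<open>i + 1\<close>.
\<close>

primrec reduced_cone :: "'a::euclidean_space set \<Rightarrow> (nat \<Rightarrow> 'a) \<Rightarrow> nat \<Rightarrow> 'a set" where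
  "reduced_cone K z 0 = K"
| "reduced_cone K z (Suc i) = reduced_cone K z i \<inter> {z i}\<^sup>\<bottom>"

definition reducing_directions ::
    "'a::euclidean_space set \<Rightarrow> 'a set \<Rightarrow> 'a set \<Rightarrow> 'a \<Rightarrow> nat \<Rightarrow> (nat \<Rightarrow> 'a) \<Rightarrow> bool" where
  "reducing_directions V K M b k z \<longleftrightarrow>
     (\<forall>i<k. z i \<in> dual_cone V (reduced_cone K z i) \<inter> orth_compl V M \<inter> orth_compl V {b})"

text \<open>
  The minimal numbers of steps are extended naturals, so that the value is \<open>\<infinity>\<close> (and not an
  arbitrary number) when no suitable sequence exists.
\<close>

definition d_PPS :: "'a::euclidean_space set \<Rightarrow> 'a set \<Rightarrow> 'a set \<Rightarrow> 'a \<Rightarrow> enat" where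
  "d_PPS V K M b =
     Inf {enat k |k. \<exists>z. reducing_directions V K M b k z \<and> PPS V (reduced_cone K z k) M b}"

definition d_S :: "'a::euclidean_space set \<Rightarrow> 'a set \<Rightarrow> 'a set \<Rightarrow> 'a \<Rightarrow> enat" where
  "d_S V K M b =
     Inf {enat k |k. \<exists>z. reducing_directions V K M b k z \<and>
       reduced_cone K z k = minimal_face K (K \<inter> (+) b ` M)}"

section \<open>Symmetric matrices\<close>

definition sym_mats :: "(real^'n^'n) set" where
  "sym_mats = {x. transpose x = x}"

definition psd_cone :: "(real^'n^'n) set" where
  "psd_cone = {x \<in> sym_mats. \<forall>v. 0 \<le> v \<bullet> (x *v v)}"

definition nonneg_cone :: "(real^'n^'n) set" where
  "nonneg_cone = {x \<in> sym_mats. \<forall>i j. 0 \<le> x $ i $ j}"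

definition dnn_cone :: "(real^'n^'n) set" where
  "dnn_cone = psd_cone \<inter> nonneg_cone"

text \<open>On symmetric matrices, the inner product of the type is the trace inner product.\<close>

lemma inner_eq_trace:
  fixes x y :: "real^'n^'n"
  assumes "y \<in> sym_mats"
  shows "x \<bullet> y = trace (x ** y)"
proof -
  have "y $ j $ i = y $ i $ j" for i j
    using assms by (metis (mono_tags, lifting) mem_Collect_eq sym_mats_def transpose_def vec_lambda_beta)
  then show ?thesis
    by (simp add: trace_def matrix_matrix_mult_def inner_vec_def)
qed

end

theory Submission
  imports Defs
begin

text \<open>
  A face of the positive semidefinite cone consists of the matrices \<open>X = (\<Sum>i. u i (u i)\<^sup>T)\<close> with all
  \<open>u i\<close> in a subspace \<open>U\<close>. Cutting it by a dual direction \<open>z\<close> shrinks \<open>U\<close> to the kernel \<open>N\<close> of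
  the form of \<open>z\<close> on \<open>U\<close>. Projecting the \<open>u i\<close> to \<open>N\<close> moves \<open>X\<close> by
  \<open>O(sqrt (norm X * (z \<bullet> X)))\<close>, by coercivity of the form on \<open>U \<inter> N\<^sup>\<bottom>\<close> and the Cauchy-Schwarz
  inequality. On the polyhedral factor the loss is linear (Hoffman). Iterating over a reducing
  sequence gives the sum of Hoelder terms, and under the partial polyhedral Slater condition the last
  cone and the affine space are regular up to a factor linear in \<open>norm x\<close>. The affine space being
  diagonal, everything is applied to \<open>(x, x)\<close>.

  If the condition fails, a separation argument produces a direction that strictly shrinks \<open>U\<close>; as
  the face is polyhedral once \<open>dim U \<le> 1\<close>, at most \<open>n - 1\<close> steps are needed.
\<close>

section \<open>Error bounds for polyhedra\<close>

text \<open>Only a cut of the semidefinite factor costs a square root, and progress is measured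
  there, by \<open>dim U\<close>. A reducing direction may cut nothing but the polyhedral factor, so
  merely separating the product cone from the affine space is too weak: the direction must be
  nonzero on the semidefinite face. Failure of the partial Slater condition supplies what this
  needs, namely that no feasible point of the polyhedral factor lies in the relative interior of the
  semidefinite face. A bound T on the residual becomes a multiple of T + sqrt (r * T), where r
  bounds the norm. As sqrt (r * e^s * r^(1-s)) = e^(s/2) * r^(1-s/2), each step halves the exponents
  and keeps every term homogeneous of degree one. The constant has to be chosen before
  \<open>Lh\<close> and \<open>ah\<close>. This is possible because \<open>Lh\<close> is forced to
  be \<open>diag L\<close>, and \<open>ah\<close> is a diagonal pair determined up to
  \<open>diag L\<close>; changing it within that freedom affects neither the reducing sequences nor
  the Slater condition.\<close>

text \<open>A short move inside a polyhedron: \<open>\<alpha>\<close> are the slacks and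
  \<open>\<beta>\<close> their rates of change. Positive slacks survive by continuity, vanishing
  ones do not decrease.\<close>

lemma small_step_nonneg:
  fixes \<alpha> \<beta> :: "'i \<Rightarrow> real"
  assumes "finite I" and "\<And>i. i \<in> I \<Longrightarrow> 0 \<le> \<alpha> i" and "\<And>i. i \<in> I \<Longrightarrow> \<alpha> i = 0 \<Longrightarrow> 0 \<le> \<beta> i"
  obtains t where "t > 0" and "\<And>i. i \<in> I \<Longrightarrow> 0 \<le> \<alpha> i + t * \<beta> i"
proof -
  have "\<forall>\<^sub>F t in at_right 0. \<forall>i\<in>I. 0 \<le> \<alpha> i + t * \<beta> i"
  proof (intro eventually_ball_finite[OF assms(1)] ballI)
    fix i assume i: "i \<in> I"
    show "\<forall>\<^sub>F t in at_right 0. 0 \<le> \<alpha> i + t * \<beta> i"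
    proof (cases "\<alpha> i = 0")
      case True
      then show ?thesis
        using assms(3)[OF i] by (auto simp: eventually_at_right_field intro!: exI[of _ 1])
    next
      case False
      then have "0 < \<alpha> i" using assms(2)[OF i] by simp
      moreover have "((\<lambda>t. \<alpha> i + t * \<beta> i) \<longlongrightarrow> \<alpha> i + 0 * \<beta> i) (at_right 0)"
        by (intro tendsto_intros)
      ultimately have "\<forall>\<^sub>F t in at_right 0. 0 < \<alpha> i + t * \<beta> i"
        by (intro order_tendstoD) auto
      then show ?thesis by eventually_elim simp
    qed
  qed
  moreover have "\<forall>\<^sub>F t in at_right (0::real). 0 < t"
    by (simp add: eventually_at_right_less)
  ultimately have "\<forall>\<^sub>F t in at_right 0. 0 < t \<and> (\<forall>i\<in>I. 0 \<le> \<alpha> i + t * \<beta> i)"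
    by eventually_elim simp
  then obtain t where "0 < t \<and> (\<forall>i\<in>I. 0 \<le> \<alpha> i + t * \<beta> i)"
    using eventually_happens' trivial_limit_at_right_real by blast
  with that show thesis by blast
qed

text \<open>The definition of \<open>polyhedron\<close> asks for nonzero normals. Admitting zero
  normals allows the normals of a system to be projected or padded freely.\<close>

lemma polyhedron_iff_inequalities:
  fixes P :: "'a::euclidean_space set"
  shows "polyhedron P \<longleftrightarrow> (\<exists>F. finite F \<and> P = {x. \<forall>(a, b)\<in>F. a \<bullet> x \<le> b})"
proof
  assume "polyhedron P"
  then obtain H where H: "finite H" "P = \<Inter>H" "\<forall>h\<in>H. \<exists>a b. a \<noteq> 0 \<and> h = {x. a \<bullet> x \<le> b}"
    unfolding polyhedron_def by blast
  then obtain a b where ab: "\<forall>h\<in>H. h = {x. a h \<bullet> x \<le> b h}"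
    by metis
  then have "P = {x. \<forall>(a, b)\<in>(\<lambda>h. (a h, b h)) ` H. a \<bullet> x \<le> b}"
    using H(2) by auto
  then show "\<exists>F. finite F \<and> P = {x. \<forall>(a, b)\<in>F. a \<bullet> x \<le> b}"
    using H(1) by blast
next
  assume "\<exists>F. finite F \<and> P = {x. \<forall>(a, b)\<in>F. a \<bullet> x \<le> b}"
  then obtain F where F: "finite F" "P = {x. \<forall>(a, b)\<in>F. a \<bullet> x \<le> b}"
    by blast
  then have "P = \<Inter>((\<lambda>(a, b). {x. a \<bullet> x \<le> b}) ` F)"
    by auto
  then show "polyhedron P"
    using F(1) by (auto intro!: polyhedron_Inter simp: polyhedron_halfspace_le)
qed

text \<open>
  If every \<open>v\<close> in the polar cone of \<open>{d. \<forall>a\<in>J. a \<bullet> d \<le> 0}\<close> satisfied all the inequalities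
  \<open>a \<bullet> v \<le> 0\<close>, it would satisfy \<open>v \<bullet> v \<le> 0\<close>; compactness of the unit sphere makes this
  quantitative.
\<close>

lemma polar_cone_violation:
  fixes J :: "'a::euclidean_space set"
  assumes "finite J"
  obtains \<kappa> where "\<kappa> > 0"
    and "\<And>v e. \<lbrakk>\<And>d. (\<And>a. a \<in> J \<Longrightarrow> a \<bullet> d \<le> 0) \<Longrightarrow> v \<bullet> d \<le> 0; 0 \<le> e; \<And>a. a \<in> J \<Longrightarrow> a \<bullet> v \<le> e\<rbrakk>
      \<Longrightarrow> norm v \<le> \<kappa> * e"
proof -
  define N where "N = {v. \<forall>d. (\<forall>a\<in>J. a \<bullet> d \<le> 0) \<longrightarrow> v \<bullet> d \<le> 0}"
  define f where "f v = (\<Sum>a\<in>J. max 0 (a \<bullet> v))" for v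
  have f_scale: "f (c *\<^sub>R v) = c * f v" if "0 \<le> c" for c v
    using that by (simp add: f_def sum_distrib_left max_mult_distrib_left)
  have N_scale: "c *\<^sub>R v \<in> N" if "0 \<le> c" "v \<in> N" for c v
    using that by (auto simp: N_def mult_nonneg_nonpos)
  have "N = (\<Inter>d\<in>{d. \<forall>a\<in>J. a \<bullet> d \<le> 0}. {v. d \<bullet> v \<le> 0})"
    by (auto simp: N_def inner_commute)
  then have "closed N"
    by (auto intro!: closed_INT simp: closed_halfspace_le)
  have f_pos: "0 < f v" if "v \<in> N" "v \<noteq> 0" for v
  proof (rule ccontr)
    assume "\<not> 0 < f v"
    moreover have "0 \<le> f v" unfolding f_def by (intro sum_nonneg) simp
    ultimately have "f v = 0" by simp
    then have "\<forall>a\<in>J. max 0 (a \<bullet> v) = 0"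
      unfolding f_def using assms by (subst (asm) sum_nonneg_eq_0_iff) auto
    then have "\<forall>a\<in>J. a \<bullet> v \<le> 0"
      by (metis max.cobounded2)
    then have "v \<bullet> v \<le> 0" using \<open>v \<in> N\<close> by (auto simp: N_def)
    with \<open>v \<noteq> 0\<close> show False by (metis inner_gt_zero_iff not_le)
  qed
  have "\<exists>m>0. \<forall>v\<in>N. m * norm v \<le> f v"
  proof (cases "N \<inter> sphere 0 1 = {}")
    case True
    have "v = 0" if v: "v \<in> N" for v
    proof (rule ccontr)
      assume "v \<noteq> 0"
      then have "(1 / norm v) *\<^sub>R v \<in> N \<inter> sphere 0 1"
        using N_scale[of "1 / norm v" v] that by simp
      with True show False by blast
    qed
    then have "\<forall>v\<in>N. 1 * norm v \<le> f v" using f_scale[of 0 0] by force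
    then show ?thesis by (intro exI[of _ 1]) simp
  next
    case False
    have "compact (N \<inter> sphere 0 1)"
      by (simp add: \<open>closed N\<close> closed_Int_compact)
    moreover have "continuous_on (N \<inter> sphere 0 1) f"
      unfolding f_def by (intro continuous_intros)
    ultimately obtain u where u: "u \<in> N \<inter> sphere 0 1" "\<forall>v\<in>N \<inter> sphere 0 1. f u \<le> f v"
      using continuous_attains_inf[OF _ False] by blast
    have "f u * norm v \<le> f v" if "v \<in> N" for v
    proof (cases "v = 0")
      case False
      then have "(1 / norm v) *\<^sub>R v \<in> N \<inter> sphere 0 1"
        using N_scale[of "1 / norm v" v] that by simp
      then have "f u \<le> (1 / norm v) * f v"
        using u(2) f_scale[of "1 / norm v" v] by force
      then show ?thesis using False by (simp add: field_simps)
    qed (simp add: f_def)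
    moreover have "f u > 0" using u by (intro f_pos) auto
    ultimately show ?thesis by blast
  qed
  then obtain m where m: "m > 0" "\<And>v. v \<in> N \<Longrightarrow> m * norm v \<le> f v" by blast
  show thesis
  proof
    show "(real (card J) + 1) / m > 0" using m by simp
    fix v and e :: real
    assume "\<And>d. (\<And>a. a \<in> J \<Longrightarrow> a \<bullet> d \<le> 0) \<Longrightarrow> v \<bullet> d \<le> 0" and "0 \<le> e"
      and v: "\<And>a. a \<in> J \<Longrightarrow> a \<bullet> v \<le> e"
    then have "v \<in> N" by (auto simp: N_def)
    have "f v \<le> (\<Sum>a\<in>J. e)"
      unfolding f_def using v \<open>0 \<le> e\<close> by (intro sum_mono) auto
    also have "\<dots> \<le> (real (card J) + 1) * e" using \<open>0 \<le> e\<close> by (simp add: algebra_simps)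
    finally have "m * norm v \<le> (real (card J) + 1) * e" using m(2)[OF \<open>v \<in> N\<close>] by simp
    then show "norm v \<le> (real (card J) + 1) / m * e"
      using m(1) by (simp add: field_simps)
  qed
qed

text \<open>With \<open>p\<close> the closest point of the polyhedron, \<open>x - p\<close> lies in
  the polar of the cone of feasible directions at \<open>p\<close>, which is cut out by the
  constraints active at \<open>p\<close>. The constant of \<open>polar_cone_violation\<close>
  depends only on the set of active normals, and there are finitely many such sets.\<close>

lemma hoffman_bound:
  fixes F :: "('a::euclidean_space \<times> real) set"
  assumes "finite F" and "{x. \<forall>(a, b)\<in>F. a \<bullet> x \<le> b} \<noteq> {}"
  obtains \<kappa> where "\<kappa> > 0"
    and "\<And>x e. \<lbrakk>0 \<le> e; \<And>a b. (a, b) \<in> F \<Longrightarrow> a \<bullet> x \<le> b + e\<rbrakk>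
      \<Longrightarrow> infdist x {x. \<forall>(a, b)\<in>F. a \<bullet> x \<le> b} \<le> \<kappa> * e"
proof -
  define P where "P = {x. \<forall>(a, b)\<in>F. a \<bullet> x \<le> b}"
  have "polyhedron P"
    unfolding polyhedron_iff_inequalities P_def using assms(1) by blast
  then have P: "closed P" "convex P"
    by (simp_all add: polyhedron_imp_closed polyhedron_imp_convex)
  have "P \<noteq> {}" using assms(2) by (simp add: P_def)
  define good where "good J \<kappa> \<longleftrightarrow> \<kappa> > 0 \<and> (\<forall>v e. (\<forall>d. (\<forall>a\<in>J. a \<bullet> d \<le> 0) \<longrightarrow> v \<bullet> d \<le> 0) \<longrightarrow> 0 \<le> e
      \<longrightarrow> (\<forall>a\<in>J. a \<bullet> v \<le> e) \<longrightarrow> norm v \<le> \<kappa> * e)" for J :: "'a set" and \<kappa> :: real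
  have "\<exists>\<kappa>. good J \<kappa>" if "finite J" for J
    using polar_cone_violation[OF that] unfolding good_def by metis
  then have "\<forall>J\<in>Pow (fst ` F). \<exists>\<kappa>. good J \<kappa>"
    using assms(1) by (meson Pow_iff finite_imageI finite_subset)
  then obtain k where k: "\<And>J. J \<subseteq> fst ` F \<Longrightarrow> good J (k J)"
    by (metis Pow_iff)
  \<comment> \<open>All the constants are positive, so their sum dominates the one for whichever
    active set occurs.\<close>
  define \<kappa> where "\<kappa> = (\<Sum>J\<in>Pow (fst ` F). k J)"
  have fin: "finite (Pow (fst ` F))" using assms(1) by simp
  have k_pos: "0 < k J" if "J \<subseteq> fst ` F" for J
    using k[OF that] by (simp add: good_def)
  have k_le: "k J \<le> \<kappa>" if "J \<subseteq> fst ` F" for J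
    unfolding \<kappa>_def using that by (intro member_le_sum fin) (auto intro: less_imp_le k_pos)
  show thesis
  proof
    show "\<kappa> > 0"
      using k_pos[of "{}"] k_le[of "{}"] by simp
    fix x e
    assume e: "0 \<le> (e::real)" and x: "\<And>a b. (a, b) \<in> F \<Longrightarrow> a \<bullet> x \<le> b + e"
    define p where "p = closest_point P x"
    have p: "p \<in> P" unfolding p_def using P \<open>P \<noteq> {}\<close> by (intro closest_point_in_set)
    define J where "J = fst ` {(a, b) \<in> F. a \<bullet> p = b}"
    have J: "J \<subseteq> fst ` F" by (auto simp: J_def)
    have "norm (x - p) \<le> k J * e"
    proof -
      \<comment> \<open>A short step from \<open>p\<close> along \<open>d\<close> stays in
        \<open>P\<close>, so the obtuse-angle property of the projection applies to it.\<close>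
      have "(x - p) \<bullet> d \<le> 0" if d: "\<forall>a\<in>J. a \<bullet> d \<le> 0" for d
      proof -
        have "\<exists>t>0. \<forall>i\<in>F. 0 \<le> (snd i - fst i \<bullet> p) + t * (- (fst i \<bullet> d))"
        proof (rule small_step_nonneg[OF assms(1), of "\<lambda>i. snd i - fst i \<bullet> p" "\<lambda>i. - (fst i \<bullet> d)"])
          show "0 \<le> snd i - fst i \<bullet> p" if "i \<in> F" for i
            using p that by (auto simp: P_def split: prod.splits)
          show "0 \<le> - (fst i \<bullet> d)" if "i \<in> F" "snd i - fst i \<bullet> p = 0" for i
          proof -
            have "fst i \<in> J" unfolding J_def using that by (intro image_eqI[of _ _ i]) auto
            then show ?thesis using d by simp
          qed
        qed blast
        then obtain t where t: "t > 0" "\<forall>i\<in>F. 0 \<le> (snd i - fst i \<bullet> p) + t * (- (fst i \<bullet> d))"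
          by blast
        then have "p + t *\<^sub>R d \<in> P"
          by (force simp: P_def inner_add_right)
        then have "(x - p) \<bullet> ((p + t *\<^sub>R d) - p) \<le> 0"
          unfolding p_def by (intro closest_point_dot P)
        then show ?thesis using t(1) by (simp add: mult_le_0_iff)
      qed
      moreover have "a \<bullet> (x - p) \<le> e" if "a \<in> J" for a
      proof -
        obtain b where "(a, b) \<in> F" "a \<bullet> p = b" using \<open>a \<in> J\<close> by (auto simp: J_def)
        then show ?thesis using x[of a b] by (simp add: inner_diff_right)
      qed
      ultimately show ?thesis
        using k[OF J] e unfolding good_def by blast
    qed
    also have "\<dots> \<le> \<kappa> * e" using k_le[OF J] e by (intro mult_right_mono)
    finally show "infdist x {x. \<forall>(a, b)\<in>F. a \<bullet> x \<le> b} \<le> \<kappa> * e"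
      using infdist_le[OF p, of x] by (simp add: dist_norm P_def)
  qed
qed

text \<open>A constraint valid on one of the sets is violated at \<open>x\<close> by at most the
  norm of its normal times the distance to that set. Hoffman's bound for the joint system turns
  violation back into distance.\<close>

lemma polyhedra_linearly_regular:
  fixes P Q :: "'a::euclidean_space set"
  assumes "polyhedron P" and "polyhedron Q" and "P \<inter> Q \<noteq> {}"
  obtains \<kappa> where "\<kappa> > 0" and "\<And>x. infdist x (P \<inter> Q) \<le> \<kappa> * (infdist x P + infdist x Q)"
proof -
  obtain F G where F: "finite F" "P = {x. \<forall>(a, b)\<in>F. a \<bullet> x \<le> b}"
    and G: "finite G" "Q = {x. \<forall>(a, b)\<in>G. a \<bullet> x \<le> b}"
    using assms(1,2) unfolding polyhedron_iff_inequalities by blast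
  have PQ: "P \<inter> Q = {x. \<forall>(a, b)\<in>F \<union> G. a \<bullet> x \<le> b}"
    using F G by auto
  have "{x. \<forall>(a, b)\<in>F \<union> G. a \<bullet> x \<le> b} \<noteq> {}" "finite (F \<union> G)"
    using assms(3) PQ F(1) G(1) by auto
  then obtain \<kappa> where \<kappa>: "\<kappa> > 0"
    and bound: "\<And>x e. \<lbrakk>0 \<le> e; \<And>a b. (a, b) \<in> F \<union> G \<Longrightarrow> a \<bullet> x \<le> b + e\<rbrakk>
      \<Longrightarrow> infdist x (P \<inter> Q) \<le> \<kappa> * e"
    unfolding PQ using hoffman_bound[of "F \<union> G"] by blast
  define m where "m = 1 + (\<Sum>i\<in>F \<union> G. norm (fst i))"
  have "m \<ge> 1" unfolding m_def by (simp add: sum_nonneg)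
  have m: "norm a \<le> m" if "(a, b) \<in> F \<union> G" for a b
  proof -
    have "norm (fst (a, b)) \<le> (\<Sum>i\<in>F \<union> G. norm (fst i))"
      using that \<open>finite (F \<union> G)\<close> by (intro member_le_sum) auto
    then show ?thesis by (simp add: m_def)
  qed
  have viol: "a \<bullet> x \<le> b + m * infdist x S"
    if S: "closed S" "S \<noteq> {}" and a: "norm a \<le> m" "\<And>y. y \<in> S \<Longrightarrow> a \<bullet> y \<le> b" for a b S and x :: 'a
  proof -
    obtain y where y: "y \<in> S" "infdist x S = dist x y"
      using infdist_attains_inf[OF S, of x] by blast
    have "a \<bullet> x = a \<bullet> y + a \<bullet> (x - y)" by (simp add: inner_diff_right)
    also have "\<dots> \<le> b + norm a * norm (x - y)"
      using a y(1) norm_cauchy_schwarz by (intro add_mono) auto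
    also have "\<dots> \<le> b + m * infdist x S"
      using a y by (auto simp: dist_norm intro!: mult_right_mono)
    finally show ?thesis .
  qed
  show thesis
  proof
    show "\<kappa> * m > 0" using \<kappa> \<open>m \<ge> 1\<close> by simp
    fix x
    have "infdist x (P \<inter> Q) \<le> \<kappa> * (m * (infdist x P + infdist x Q))"
    proof (rule bound)
      show "0 \<le> m * (infdist x P + infdist x Q)" using \<open>m \<ge> 1\<close> by (simp add: infdist_nonneg)
      fix a b assume ab: "(a, b) \<in> F \<union> G"
      have "0 \<le> m * infdist x P" "0 \<le> m * infdist x Q"
        using \<open>m \<ge> 1\<close> by (simp_all add: infdist_nonneg)
      moreover have "a \<bullet> x \<le> b + m * infdist x P \<or> a \<bullet> x \<le> b + m * infdist x Q"
        using ab
      proof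
        assume "(a, b) \<in> F"
        then have "a \<bullet> x \<le> b + m * infdist x P"
          using m[OF ab] F assms polyhedron_imp_closed by (intro viol) auto
        then show ?thesis ..
      next
        assume "(a, b) \<in> G"
        then have "a \<bullet> x \<le> b + m * infdist x Q"
          using m[OF ab] G assms polyhedron_imp_closed by (intro viol) auto
        then show ?thesis ..
      qed
      ultimately show "a \<bullet> x \<le> b + m * (infdist x P + infdist x Q)"
        by (auto simp: distrib_left)
    qed
    then show "infdist x (P \<inter> Q) \<le> \<kappa> * m * (infdist x P + infdist x Q)"
      by (simp add: mult.assoc)
  qed
qed

section \<open>The partial polyhedral Slater condition\<close>

lemma orthogonal_decomposition:
  fixes U :: "'a::euclidean_space set"
  assumes "subspace U"
  obtains v w where "x = v + w" and "v \<in> U" and "\<And>y. y \<in> U \<Longrightarrow> y \<bullet> w = 0"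
proof -
  have "x \<in> U + U\<^sup>\<bottom>" using subspace_sum_orthogonal_comp[OF assms] by simp
  then show thesis
    using that by (auto elim!: set_plus_elim simp: orthogonal_comp_def orthogonal_def)
qed

text \<open>Once the normals of \<open>C\<close> are projected to \<open>W\<close> they no longer
  see the component in \<open>S\<close>, so the same inequalities describe the sum inside
  \<open>S + W\<close>.\<close>

lemma polyhedron_orthogonal_sum:
  fixes S C :: "'a::euclidean_space set"
  assumes "subspace S" and "subspace W" and orth: "\<And>u v. u \<in> S \<Longrightarrow> v \<in> W \<Longrightarrow> u \<bullet> v = 0"
    and "polyhedron C" and "C \<subseteq> W"
  shows "polyhedron (S + C)"
proof -
  obtain F where F: "finite F" "C = {x. \<forall>(a, b)\<in>F. a \<bullet> x \<le> b}"
    using assms(4) polyhedron_iff_inequalities by blast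
  have "\<exists>a'\<in>W. \<forall>v\<in>W. a' \<bullet> v = a \<bullet> v" for a
  proof -
    obtain v w where "a = v + w" "v \<in> W" "\<And>y. y \<in> W \<Longrightarrow> y \<bullet> w = 0"
      using orthogonal_decomposition[OF assms(2), of a] by blast
    then show ?thesis by (intro bexI[of _ v]) (auto simp: inner_add_left inner_commute[of w])
  qed
  then obtain \<pi> where \<pi>: "\<And>a. \<pi> a \<in> W" "\<And>a v. v \<in> W \<Longrightarrow> \<pi> a \<bullet> v = a \<bullet> v"
    by metis
  have "S + C = (S + W) \<inter> {x. \<forall>(a, b)\<in>(\<lambda>(a, b). (\<pi> a, b)) ` F. a \<bullet> x \<le> b}" (is "_ = _ \<inter> ?Q")
  proof (intro set_eqI iffI)
    fix x assume "x \<in> S + C"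
    then obtain s c where sc: "x = s + c" "s \<in> S" "c \<in> C" by (auto elim!: set_plus_elim)
    then have "c \<in> W" using assms(5) by blast
    then have "\<pi> a \<bullet> x = a \<bullet> c" for a
      using \<pi>(2)[of c a] orth[OF sc(2) \<pi>(1)[of a]] by (simp add: sc(1) inner_add_right inner_commute)
    then have "x \<in> ?Q" using sc(3) F(2) by auto
    then show "x \<in> (S + W) \<inter> ?Q" using sc assms(5) by blast
  next
    fix x assume x: "x \<in> (S + W) \<inter> ?Q"
    then obtain s w where sw: "x = s + w" "s \<in> S" "w \<in> W" by (auto elim!: set_plus_elim)
    then have "\<pi> a \<bullet> x = a \<bullet> w" for a
      using \<pi>(2)[of w a] orth[OF sw(2) \<pi>(1)[of a]] by (simp add: inner_add_right inner_commute)
    then have "w \<in> C" using x F(2) by auto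
    then show "x \<in> S + C" using sw by blast
  qed
  moreover have "polyhedron (S + W)"
  proof -
    have "S + W = {x + y |x y. x \<in> S \<and> y \<in> W}" by (auto simp: set_plus_def)
    then show ?thesis
      using subspace_sums[OF assms(1,2)] by (simp add: affine_imp_polyhedron subspace_imp_affine)
  qed
  moreover have "polyhedron ?Q"
    unfolding polyhedron_iff_inequalities using F(1) by blast
  ultimately show ?thesis by simp
qed

text \<open>
  Replacing \<open>C1\<close> by its span makes the problem polyhedral; a point of the polyhedral relaxation is
  pulled into \<open>C1 + C2\<close> by moving towards the Slater point.
\<close>

lemma PPS_error_bound:
  assumes "PPS V C M b" and "subspace M" and "closed C"
  obtains \<kappa> where "\<kappa> > 0"
    and "\<And>x e. \<lbrakk>infdist x C \<le> e; infdist x ((+) b ` M) \<le> e\<rbrakk>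
      \<Longrightarrow> infdist x (C \<inter> (+) b ` M) \<le> (\<kappa> * norm x + \<kappa>) * e"
proof -
  define A where "A = (+) b ` M"
  have "affine A"
    unfolding A_def using assms(2) by (metis affine_translation subspace_imp_affine)
  obtain V1 V2 C1 C2 x1 x2 where V: "subspace V1" "subspace V2" "\<forall>u\<in>V1. \<forall>v\<in>V2. orthogonal u v"
    and C1: "C1 \<subseteq> V1" "convex_cone C1"
    and C2: "C2 \<subseteq> V2" "convex_cone C2" "polyhedron C2"
    and C: "C = C1 + C2" "closed C1" "closed C2"
    and x1: "x1 \<in> rel_interior C1" and x2: "x2 \<in> C2" "x1 + x2 \<in> A"
    using assms(1) unfolding PPS_def A_def by auto
  define S where "S = span C1"
  have S: "S \<subseteq> V1" "C1 \<subseteq> S" unfolding S_def using C1 V by (auto simp: span_base span_minimal)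
  have orth: "u \<bullet> v = 0" if "u \<in> V1" "v \<in> V2" for u v
    using V(3) that by (simp add: orthogonal_def)
  have "affine hull C1 = S"
    unfolding S_def using convex_cone_contains_0[OF C1(2)] by (intro affine_hull_span_0 hull_inc)
  then obtain \<delta> where \<delta>: "\<delta> > 0" "cball x1 \<delta> \<inter> S \<subseteq> C1" "x1 \<in> C1"
    using x1 unfolding mem_rel_interior_cball by auto
  define xb where "xb = x1 + x2"
  define P where "P = S + C2"
  have "polyhedron P"
    unfolding P_def by (rule polyhedron_orthogonal_sum[OF _ V(2) _ C2(3,1)])
      (use S orth in \<open>auto simp: S_def\<close>)
  have "polyhedron A" using \<open>affine A\<close> by (rule affine_imp_polyhedron)
  have "C \<subseteq> P" unfolding C P_def using S(2) by (rule set_plus_mono2) simp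
  have xb: "xb \<in> P \<inter> A" "xb \<in> C \<inter> A"
    using \<delta>(3) x2 \<open>C \<subseteq> P\<close> unfolding xb_def C(1) by blast+
  then have "P \<inter> A \<noteq> {}" by blast
  then obtain h where h: "h > 0" "\<And>x. infdist x (P \<inter> A) \<le> h * (infdist x P + infdist x A)"
    using polyhedra_linearly_regular[OF \<open>polyhedron P\<close> \<open>polyhedron A\<close>] by blast
  have PA: "closed (P \<inter> A)" "convex (P \<inter> A)"
    using \<open>polyhedron P\<close> \<open>polyhedron A\<close> by (simp_all add: polyhedron_imp_closed polyhedron_imp_convex)
  \<comment> \<open>The term \<open>2 * h\<close> pays for going from \<open>x\<close> to the
    relaxed solution \<open>y\<close>. The other term pays for pulling \<open>y\<close> towards
    \<open>xb\<close>, over a distance of at most \<open>norm x + norm xb\<close>.\<close>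
  define k where "k = 2 * h + (1 + 2 * h) / \<delta> * (1 + norm xb)"
  show thesis
  proof
    have "1 + norm xb > 0" by (simp add: add_pos_nonneg)
    then have "0 < (1 + 2 * h) / \<delta> * (1 + norm xb)"
      using h(1) \<delta>(1) by (intro mult_pos_pos[OF divide_pos_pos]) linarith+
    then show "k > 0" unfolding k_def using h(1) by linarith
    fix x e
    assume xC: "infdist x C \<le> e" and xA: "infdist x ((+) b ` M) \<le> e"
    have "0 \<le> e" using xC infdist_nonneg[of x C] by linarith
    define y where "y = closest_point (P \<inter> A) x"
    have y: "y \<in> P \<inter> A" unfolding y_def using PA \<open>P \<inter> A \<noteq> {}\<close> by (intro closest_point_in_set)
    have "dist x y = infdist x (P \<inter> A)"
      unfolding y_def infdist_eq_setdist using PA(1) \<open>P \<inter> A \<noteq> {}\<close> by (simp add: setdist_closest_point)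
    also have "\<dots> \<le> h * (e + e)"
    proof -
      have "infdist x P \<le> infdist x C"
        using \<open>C \<subseteq> P\<close> xb by (intro infdist_mono) auto
      then have "infdist x P + infdist x A \<le> e + e"
        using xC xA unfolding A_def by linarith
      then show ?thesis
        using h(1) by (intro order_trans[OF h(2)] mult_left_mono) auto
    qed
    finally have xy: "dist x y \<le> 2 * h * e" by simp
    \<comment> \<open>Projection is nonexpansive and fixes \<open>xb\<close>, so \<open>y\<close> is
      no farther from the Slater point than \<open>x\<close> is.\<close>
    have "xb = closest_point (P \<inter> A) xb" using xb by (simp add: closest_point_self)
    then have "dist y xb \<le> dist x xb"
      unfolding y_def using closest_point_lipschitz[OF PA(2,1) \<open>P \<inter> A \<noteq> {}\<close>] by metis
    also have "\<dots> \<le> norm x + norm xb" by (simp add: dist_norm norm_triangle_ineq4)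
    finally have y_xb: "dist y xb \<le> norm x + norm xb" .
    \<comment> \<open>Bounds the distance from \<open>y\<close> to \<open>C\<close>: at most
      \<open>e\<close> from \<open>x\<close>, plus \<open>2 * h * e\<close> for moving from
      \<open>x\<close> to \<open>y\<close>.\<close>
    define e' where "e' = (1 + 2 * h) * e"
    have "0 \<le> e'" using \<open>0 \<le> e\<close> h(1) by (simp add: e'_def)
    have "infdist y C \<le> e'"
      using infdist_triangle[of y C x] xC xy by (simp add: e'_def dist_commute algebra_simps)
    then obtain c where c: "c \<in> C" "dist y c \<le> e'"
      using infdist_attains_inf[OF \<open>closed C\<close>, of y] xb by force
    obtain y1 y2 where y12: "y = y1 + y2" "y1 \<in> S" "y2 \<in> C2"
      using y by (auto simp: P_def elim!: set_plus_elim)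
    obtain c1 c2 where c12: "c = c1 + c2" "c1 \<in> C1" "c2 \<in> C2"
      using c by (auto simp: C elim!: set_plus_elim)
    define r where "r = y1 - c1"
    have "r \<in> S" unfolding r_def S_def using y12 c12 S by (auto simp: S_def intro: span_diff)
    \<comment> \<open>The two factors are orthogonal, so the defect in the first one is at most the
      whole distance from \<open>y\<close> to \<open>c\<close>.\<close>
    have "norm r \<le> norm (r + (y2 - c2))"
    proof -
      have "r \<bullet> (y2 - c2) = 0"
        using \<open>r \<in> S\<close> S(1) y12(3) c12(3) C2(1) subspace_diff[OF V(2), of y2 c2] by (intro orth) blast+
      then have "(norm (r + (y2 - c2)))\<^sup>2 = (norm r)\<^sup>2 + (norm (y2 - c2))\<^sup>2"
        by (simp add: power2_norm_eq_inner inner_add inner_commute)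
      then have "(norm r)\<^sup>2 \<le> (norm (r + (y2 - c2)))\<^sup>2" by simp
      then show ?thesis by (rule power2_le_imp_le) simp
    qed
    also have "\<dots> = dist y c" by (simp add: r_def dist_norm y12 c12 algebra_simps)
    finally have r: "norm r \<le> e'" using c by simp
    have "\<exists>w\<in>C \<inter> A. dist y w \<le> e' / \<delta> * dist y xb"
    proof (cases "e' = 0")
      case True
      then have "y \<in> C \<inter> A" using c y by simp
      then show ?thesis using True by (intro bexI[of _ y]) auto
    next
      case False
      then have "e' > 0" using \<open>0 \<le> e'\<close> by simp
      \<comment> \<open>Normalises the weights \<open>\<delta>\<close> and \<open>e'\<close> of a
        convex combination of \<open>y\<close> and \<open>xb\<close>. With these weights the defect
        \<open>r\<close> of \<open>y\<close> fits into the ball of radius \<open>\<delta>\<close>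
        around \<open>x1\<close>.\<close>
      define s where "s = 1 / (\<delta> + e')"
      have s: "s > 0" "s * \<delta> + s * e' = 1" using \<delta>(1) \<open>e' > 0\<close> by (auto simp: s_def add_divide_distrib[symmetric])
      define w where "w = (s * \<delta>) *\<^sub>R y + (s * e') *\<^sub>R xb"
      have "w \<in> A"
        unfolding w_def using \<open>affine A\<close> s(2) y xb by (auto simp: affine_def)
      moreover have "w \<in> C"
      proof -
        \<comment> \<open>The Slater point absorbs the rescaled defect: the weighted sum of
          \<open>c1\<close> and \<open>q\<close> equals that of \<open>y1\<close> and
          \<open>x1\<close>.\<close>
        define q where "q = x1 + (\<delta> / e') *\<^sub>R r"
        have "norm ((\<delta> / e') *\<^sub>R r) \<le> \<delta>"
          using r \<delta>(1) \<open>e' > 0\<close> by (simp add: field_simps)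
        moreover have "q \<in> S"
          unfolding q_def using \<open>r \<in> S\<close> \<delta>(3) S by (auto simp: S_def intro: span_add span_mul)
        ultimately have "q \<in> C1" using \<delta>(2) by (auto simp: q_def dist_norm)
        then have "(s * \<delta>) *\<^sub>R c1 + (s * e') *\<^sub>R q \<in> C1"
          using C1(2) c12(2) s(1) \<delta>(1) \<open>e' > 0\<close> by (auto intro!: convex_cone_add convex_cone_scaleR)
        moreover have "(s * \<delta>) *\<^sub>R y2 + (s * e') *\<^sub>R x2 \<in> C2"
          using C2(2) y12(3) x2(1) s(1) \<delta>(1) \<open>e' > 0\<close> by (auto intro!: convex_cone_add convex_cone_scaleR)
        moreover have "w = ((s * \<delta>) *\<^sub>R c1 + (s * e') *\<^sub>R q) + ((s * \<delta>) *\<^sub>R y2 + (s * e') *\<^sub>R x2)"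
          using \<open>e' > 0\<close> by (simp add: w_def q_def r_def y12 xb_def algebra_simps)
        ultimately show ?thesis unfolding C by blast
      qed
      moreover have "dist y w = s * e' * dist y xb"
      proof -
        have "y - w = (s * e') *\<^sub>R (y - xb)"
        proof -
          have "y = (s * \<delta> + s * e') *\<^sub>R y" using s(2) by simp
          then show ?thesis unfolding w_def by (simp add: algebra_simps)
        qed
        then show ?thesis using s(1) \<open>e' > 0\<close> by (simp add: dist_norm)
      qed
      moreover have "s * e' \<le> e' / \<delta>" using \<delta>(1) \<open>e' > 0\<close> by (simp add: s_def field_simps)
      ultimately show ?thesis
        using mult_right_mono[of "s * e'" "e' / \<delta>" "dist y xb"] by (intro bexI[of _ w]) auto
    qed
    then obtain w where w: "w \<in> C \<inter> A" "dist y w \<le> e' / \<delta> * dist y xb" by blast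
    have "infdist x (C \<inter> A) \<le> dist x w" using w by (intro infdist_le)
    also have "\<dots> \<le> dist x y + dist y w" by (rule dist_triangle)
    also have "\<dots> \<le> 2 * h * e + e' / \<delta> * (norm x + norm xb)"
      using \<open>0 \<le> e'\<close> \<delta>(1) by (intro add_mono xy order_trans[OF w(2)] mult_left_mono y_xb) simp
    also have "\<dots> = (2 * h + (1 + 2 * h) / \<delta> * (norm x + norm xb)) * e"
      by (simp add: e'_def algebra_simps)
    also have "\<dots> \<le> (k * norm x + k) * e"
    proof (intro mult_right_mono \<open>0 \<le> e\<close>)
      define g where "g = (1 + 2 * h) / \<delta>"
      have "g \<ge> 0" using h(1) \<delta>(1) by (simp add: g_def)
      then have "0 \<le> g * norm xb * norm x" "0 \<le> h * norm x" using h(1) by simp_all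
      then show "2 * h + (1 + 2 * h) / \<delta> * (norm x + norm xb) \<le> k * norm x + k"
        using \<open>g \<ge> 0\<close> unfolding k_def g_def[symmetric] by (simp add: algebra_simps)
    qed
    finally show "infdist x (C \<inter> (+) b ` M) \<le> (k * norm x + k) * e"
      by (simp add: A_def)
  qed
qed

section \<open>Faces of the positive semidefinite cone\<close>

definition tens :: "real^'n \<Rightarrow> real^'n \<Rightarrow> real^'n^'n" where
  "tens u v = (\<chi> i j. u $ i * v $ j)"

lemma tens_vector_mult: "tens u v *v w = (v \<bullet> w) *\<^sub>R u"
  by (simp add: tens_def matrix_vector_mult_def vec_eq_iff inner_vec_def sum_distrib_left mult_ac)

lemma inner_tens: "tens u v \<bullet> z = u \<bullet> (z *v v)"
  by (simp add: tens_def inner_vec_def matrix_vector_mult_def sum_distrib_left mult_ac)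

lemma norm_tens: "norm (tens u v) = norm u * norm v"
proof -
  have "(norm (tens u v))\<^sup>2 = (norm u * norm v)\<^sup>2"
    by (simp add: power2_norm_eq_inner inner_tens tens_vector_mult power_mult_distrib)
  then show ?thesis by (simp add: power2_eq_iff_nonneg)
qed

lemma subspace_sym_mats: "subspace sym_mats"
  by (auto simp: subspace_def sym_mats_def transpose_def vec_eq_iff)

lemma tens_sym: "tens u u \<in> sym_mats"
  by (simp add: sym_mats_def tens_def transpose_def vec_eq_iff)

lemma sym_mats_inner_swap:
  assumes "X \<in> sym_mats"
  shows "x \<bullet> (X *v y) = y \<bullet> (X *v x)"
proof -
  have "x \<bullet> (X *v y) = (x v* X) \<bullet> y" by (simp add: dot_lmul_matrix)
  also have "x v* X = X *v x"
    using assms vector_transpose_matrix[of x X] by (simp add: sym_mats_def)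
  finally show ?thesis by (simp add: inner_commute)
qed

lemma quadratic_form_add:
  assumes "X \<in> sym_mats"
  shows "(x + t *\<^sub>R y) \<bullet> (X *v (x + t *\<^sub>R y))
    = x \<bullet> (X *v x) + 2 * t * (y \<bullet> (X *v x)) + t\<^sup>2 * (y \<bullet> (X *v y))"
  using sym_mats_inner_swap[OF assms, of x y]
  by (simp add: matrix_vector_right_distrib matrix_vector_mult_scaleR inner_add power2_eq_square algebra_simps)

lemma tens_psd: "tens u u \<in> psd_cone"
  by (auto simp: psd_cone_def tens_sym tens_vector_mult inner_commute)

lemma convex_cone_psd: "convex_cone psd_cone"
  unfolding convex_cone_iff
  by (auto simp: psd_cone_def subspace_sym_mats subspace_0 subspace_add subspace_scale
      matrix_vector_mult_add_rdistrib inner_add_right scaleR_matrix_vector_assoc[symmetric])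

text \<open>Rank-one deflation, as in a Cholesky factorisation: subtracting a suitable outer product
  keeps the matrix semidefinite and strictly shrinks its range. As the ranges are nested, all the
  vectors lie in the range of the original \<open>X\<close>.\<close>

lemma psd_decomposition:
  fixes X :: "real^'n^'n"
  assumes "X \<in> psd_cone"
  obtains m u where "X = (\<Sum>i<m::nat. tens (u i) (u i))" and "\<And>i. i < m \<Longrightarrow> u i \<in> range ((*v) X)"
proof -
  have "\<exists>m u. X = (\<Sum>i<m::nat. tens (u i) (u i)) \<and> (\<forall>i<m. u i \<in> range ((*v) X))"
    using assms
  proof (induction "dim (range ((*v) X))" arbitrary: X rule: less_induct)
    case less
    note psd = less.prems
    have sym: "X \<in> sym_mats" and nonneg: "\<And>v. 0 \<le> v \<bullet> (X *v v)"
      using psd by (auto simp: psd_cone_def)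
    show ?case
    proof (cases "\<forall>v. v \<bullet> (X *v v) = 0")
      case True
      \<comment> \<open>Polarisation: a symmetric form that vanishes at every vector vanishes at
        every pair.\<close>
      have "y \<bullet> (X *v x) = 0" for x y
        using quadratic_form_add[OF sym, of x 1 y] True by simp
      then have "X *v x = 0 *v x" for x
        by (metis inner_eq_zero_iff matrix_vector_mult_0)
      then have "X = 0" by (simp add: matrix_eq)
      then show ?thesis by (intro exI[of _ 0]) simp
    next
      case False
      then obtain v where "v \<bullet> (X *v v) \<noteq> 0" by blast
      define c where "c = v \<bullet> (X *v v)"
      have "c > 0" using nonneg[of v] \<open>v \<bullet> (X *v v) \<noteq> 0\<close> by (simp add: c_def)
      \<comment> \<open>The scaling by \<open>sqrt c\<close> is chosen to put \<open>v\<close> into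
        the kernel of \<open>Y\<close>.\<close>
      define w where "w = (1 / sqrt c) *\<^sub>R (X *v v)"
      define Y where "Y = X - tens w w"
      have w_inner: "(w \<bullet> y) = (y \<bullet> (X *v v)) / sqrt c" for y
        by (simp add: w_def inner_commute)
      have Y_mult: "Y *v y = X *v y - (w \<bullet> y) *\<^sub>R w" for y
        by (simp add: Y_def matrix_vector_mult_diff_rdistrib tens_vector_mult)
      have "Y \<in> sym_mats"
        unfolding Y_def by (intro subspace_diff subspace_sym_mats sym tens_sym)
      moreover have "0 \<le> y \<bullet> (Y *v y)" for y
      proof -
        define s where "s = y \<bullet> (X *v v)"
        \<comment> \<open>The shift by \<open>- s / c\<close> minimises the form on the line through
          \<open>y\<close> in direction \<open>v\<close>; the minimum is the form of
          \<open>Y\<close> at \<open>y\<close>.\<close>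
        have "0 \<le> (y + (- s / c) *\<^sub>R v) \<bullet> (X *v (y + (- s / c) *\<^sub>R v))" by (rule nonneg)
        also have "\<dots> = y \<bullet> (X *v y) - s\<^sup>2 / c"
          unfolding quadratic_form_add[OF sym] c_def[symmetric] sym_mats_inner_swap[OF sym, of v y] s_def[symmetric]
          using \<open>c > 0\<close> by (simp add: power2_eq_square field_simps)
        also have "s\<^sup>2 / c = (w \<bullet> y)\<^sup>2"
          using \<open>c > 0\<close> by (simp add: w_inner s_def power_divide)
        finally show ?thesis
          by (simp add: Y_mult inner_diff_right power2_eq_square inner_commute)
      qed
      ultimately have "Y \<in> psd_cone" by (simp add: psd_cone_def)
      have w_range: "w \<in> range ((*v) X)"
        by (auto simp: w_def matrix_vector_mult_scaleR[symmetric])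
      have sub: "subspace (range ((*v) X))" for X :: "real^'n^'n"
        by (intro linear_subspace_image) auto
      have Y_range: "range ((*v) Y) \<subseteq> range ((*v) X)"
        using w_range by (auto simp: Y_mult intro!: subspace_diff[OF sub] subspace_scale[OF sub])
      \<comment> \<open>Hence the range of \<open>Y\<close> is orthogonal to \<open>v\<close>,
        whereas \<open>X *v v\<close> is not; this makes the inclusion of ranges strict.\<close>
      have "Y *v v = 0"
        using \<open>c > 0\<close> by (simp add: Y_mult w_inner c_def[symmetric]) (simp add: w_def real_div_sqrt flip: c_def)
      then have "v \<bullet> (Y *v y) = 0" for y
        using sym_mats_inner_swap[OF \<open>Y \<in> sym_mats\<close>, of v y] by simp
      moreover have "v \<bullet> (X *v v) \<noteq> 0" by fact
      ultimately have "X *v v \<notin> range ((*v) Y)" by auto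
      then have "range ((*v) Y) \<subset> range ((*v) X)" using Y_range by blast
      then have "dim (range ((*v) Y)) < dim (range ((*v) X))"
        using sub by (metis dim_psubset span_eq_iff)
      then obtain m u where mu: "Y = (\<Sum>i<m::nat. tens (u i) (u i))" "\<forall>i<m. u i \<in> range ((*v) Y)"
        using less.hyps \<open>Y \<in> psd_cone\<close> by blast
      have "X = (\<Sum>i<Suc m. tens ((u(m := w)) i) ((u(m := w)) i))"
        using mu(1) by (simp add: Y_def algebra_simps)
      moreover have "\<forall>i<Suc m. (u(m := w)) i \<in> range ((*v) X)"
        using mu(2) w_range Y_range by (auto simp: less_Suc_eq)
      ultimately show ?thesis by blast
    qed
  qed
  with that show thesis by blast
qed

section \<open>The face attached to a subspace\<close>

text \<open>Phrased by the range, so that the vectors given by \<open>psd_decomposition\<close> lie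
  in \<open>U\<close> at once.\<close>

definition psd_face :: "(real^'n) set \<Rightarrow> (real^'n^'n) set" where
  "psd_face U = {X \<in> psd_cone. range ((*v) X) \<subseteq> U}"

lemma psd_face_UNIV: "psd_face UNIV = psd_cone"
  by (simp add: psd_face_def)

lemma psd_face_subset_sym: "psd_face U \<subseteq> sym_mats"
  by (auto simp: psd_face_def psd_cone_def)

lemma convex_cone_psd_face:
  assumes "subspace U"
  shows "convex_cone (psd_face U)"
  using convex_cone_psd assms unfolding convex_cone_iff psd_face_def
  by (auto simp: matrix_vector_mult_add_rdistrib scaleR_matrix_vector_assoc[symmetric] image_subset_iff
      subspace_0 subspace_add subspace_scale)

lemma closed_psd_face:
  fixes U :: "(real^'n) set"
  assumes "subspace U"
  shows "closed (psd_face U)"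
proof -
  have cont: "continuous_on UNIV (\<lambda>X :: real^'n^'n. X *v v)" for v
    unfolding matrix_vector_mult_def by (intro continuous_intros)
  have "psd_face U = sym_mats \<inter> (\<Inter>v. {X. 0 \<le> v \<bullet> (X *v v)}) \<inter> (\<Inter>v. (\<lambda>X. X *v v) -` U)"
    by (auto simp: psd_face_def psd_cone_def)
  moreover have "closed {X :: real^'n^'n. 0 \<le> v \<bullet> (X *v v)}" for v
    by (intro closed_Collect_le continuous_intros cont)
  moreover have "closed ((\<lambda>X :: real^'n^'n. X *v v) -` U)" for v
    using closed_subspace[OF assms] cont by (rule closed_vimage)
  ultimately show ?thesis
    by (simp add: closed_INT closed_Int closed_subspace subspace_sym_mats)
qed

lemma tens_psd_face:
  assumes "subspace U" and "u \<in> U"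
  shows "tens u u \<in> psd_face U"
  using assms by (auto simp: psd_face_def tens_psd tens_vector_mult subspace_scale)

lemma sum_tens_psd_face:
  assumes "subspace U" and "\<And>i. i \<in> I \<Longrightarrow> u i \<in> U"
  shows "(\<Sum>i\<in>I. tens (u i) (u i)) \<in> psd_face U"
  using assms(2)
proof (induction I rule: infinite_finite_induct)
  case (insert i I)
  then show ?case
    using tens_psd_face[OF assms(1)] convex_cone_add[OF convex_cone_psd_face[OF assms(1)]] by simp
qed (use convex_cone_contains_0[OF convex_cone_psd_face[OF assms(1)]] in auto)

lemma psd_face_decomposition:
  fixes X :: "real^'n^'n"
  assumes "X \<in> psd_face U"
  obtains m u where "X = (\<Sum>i<m::nat. tens (u i) (u i))" and "\<And>i. i < m \<Longrightarrow> u i \<in> U"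
proof -
  have "X \<in> psd_cone" "range ((*v) X) \<subseteq> U" using assms by (auto simp: psd_face_def)
  with psd_decomposition[OF this(1)] that show thesis by (metis subsetD)
qed

lemma dual_psd_face:
  assumes "subspace U" and "z \<in> dual_cone sym_mats (psd_face U)"
  shows "z \<in> sym_mats" and "\<And>u. u \<in> U \<Longrightarrow> 0 \<le> u \<bullet> (z *v u)"
proof -
  show "z \<in> sym_mats" using assms(2) by (simp add: dual_cone_def)
  fix u assume "u \<in> U"
  then have "0 \<le> z \<bullet> tens u u"
    using assms(2) tens_psd_face[OF assms(1)] by (simp add: dual_cone_def)
  then show "0 \<le> u \<bullet> (z *v u)" by (simp add: inner_commute[of z] inner_tens)
qed

section \<open>Cutting a semidefinite face by a dual direction\<close>

text \<open>The condition is quadratic, but for dual \<open>z\<close> the form is nonnegative on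
  \<open>U\<close>, and its zeros are then its kernel, a subspace.\<close>

definition zero_set :: "(real^'n) set \<Rightarrow> real^'n^'n \<Rightarrow> (real^'n) set" where
  "zero_set U z = {u \<in> U. u \<bullet> (z *v u) = 0}"

text \<open>If the mixed term were nonzero, moving from \<open>r\<close> along \<open>p\<close>
  would change the form linearly, and the form would become negative somewhere in
  \<open>U\<close>.\<close>

lemma zero_set_inner:
  assumes "subspace U" and "z \<in> dual_cone sym_mats (psd_face U)"
    and "p \<in> zero_set U z" and "r \<in> U"
  shows "p \<bullet> (z *v r) = 0"
proof (rule ccontr)
  assume nz: "p \<bullet> (z *v r) \<noteq> 0"
  \<comment> \<open>Solves for the value -1 of the form.\<close>
  define t where "t = - (r \<bullet> (z *v r) + 1) / (2 * (p \<bullet> (z *v r)))"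
  have "r + t *\<^sub>R p \<in> U"
    using assms by (auto simp: zero_set_def intro!: subspace_add subspace_scale)
  then have "0 \<le> (r + t *\<^sub>R p) \<bullet> (z *v (r + t *\<^sub>R p))"
    by (rule dual_psd_face(2)[OF assms(1,2)])
  also have "\<dots> = r \<bullet> (z *v r) + 2 * t * (p \<bullet> (z *v r))"
    using assms(3) by (simp add: quadratic_form_add[OF dual_psd_face(1)[OF assms(1,2)]] zero_set_def)
  also have "\<dots> = -1" using nz by (simp add: t_def field_simps)
  finally show False by simp
qed

lemma subspace_zero_set:
  assumes "subspace U" and "z \<in> dual_cone sym_mats (psd_face U)"
  shows "subspace (zero_set U z)"
  unfolding subspace_def
proof (intro conjI ballI allI)
  show "0 \<in> zero_set U z" using assms(1) by (simp add: zero_set_def subspace_0)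
next
  fix x y assume xy: "x \<in> zero_set U z" "y \<in> zero_set U z"
  have "x \<in> U" using xy(1) by (simp add: zero_set_def)
  with zero_set_inner[OF assms xy(2)] have "y \<bullet> (z *v x) = 0" by blast
  with xy show "x + y \<in> zero_set U z"
    using quadratic_form_add[OF dual_psd_face(1)[OF assms], of x 1 y] assms(1)
    by (simp add: zero_set_def subspace_add)
next
  fix c x assume "x \<in> zero_set U z"
  then show "c *\<^sub>R x \<in> zero_set U z"
    using assms(1) by (simp add: zero_set_def subspace_scale matrix_vector_mult_scaleR)
qed

text \<open>For a sum of outer products, \<open>z \<bullet> X\<close> is the sum of the values of
  the form at the vectors \<open>u i\<close>. These are nonnegative, so the sum vanishes only if
  each does.\<close>

lemma psd_face_Int_orthogonal:
  assumes "subspace U" and "z \<in> dual_cone sym_mats (psd_face U)"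
  shows "psd_face U \<inter> {X. z \<bullet> X = 0} = psd_face (zero_set U z)"
proof (intro set_eqI iffI)
  fix X assume X: "X \<in> psd_face U \<inter> {X. z \<bullet> X = 0}"
  then obtain m u where mu: "X = (\<Sum>i<m::nat. tens (u i) (u i))" "\<And>i. i < m \<Longrightarrow> u i \<in> U"
    using psd_face_decomposition by blast
  have "(\<Sum>i<m. u i \<bullet> (z *v u i)) = 0"
    using X by (simp add: mu(1) inner_commute[of z] inner_sum_left inner_tens)
  then have "\<forall>i\<in>{..<m}. u i \<bullet> (z *v u i) = 0"
    using mu(2) dual_psd_face(2)[OF assms] by (subst (asm) sum_nonneg_eq_0_iff) auto
  then have "u i \<in> zero_set U z" if "i < m" for i using that mu(2) by (simp add: zero_set_def)
  then show "X \<in> psd_face (zero_set U z)"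
    unfolding mu(1) using subspace_zero_set[OF assms] by (intro sum_tens_psd_face) auto
next
  fix X assume X: "X \<in> psd_face (zero_set U z)"
  then obtain m u where mu: "X = (\<Sum>i<m::nat. tens (u i) (u i))" "\<And>i. i < m \<Longrightarrow> u i \<in> zero_set U z"
    using psd_face_decomposition by blast
  then have "z \<bullet> X = 0"
    by (simp add: inner_commute[of z] inner_sum_left inner_tens zero_set_def)
  moreover have "X \<in> psd_face U" using X by (auto simp: psd_face_def zero_set_def)
  ultimately show "X \<in> psd_face U \<inter> {X. z \<bullet> X = 0}" by simp
qed

text \<open>
  Since \<open>zero_set U z\<close> is the kernel of the form on \<open>U\<close>, the form is coercive in the directions
  orthogonal to it.
\<close>

lemma zero_set_coercive:
  assumes "subspace U" and "z \<in> dual_cone sym_mats (psd_face U)"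
  obtains c where "c > 0"
    and "\<And>u. u \<in> U \<Longrightarrow> \<exists>p q. u = p + q \<and> p \<in> zero_set U z \<and> p \<bullet> q = 0 \<and> c * (norm q)\<^sup>2 \<le> u \<bullet> (z *v u)"
proof -
  define N where "N = zero_set U z"
  have N: "subspace N" unfolding N_def by (rule subspace_zero_set[OF assms])
  define W where "W = U \<inter> N\<^sup>\<bottom>"
  have W: "subspace W"
    unfolding W_def by (intro subspace_inter assms(1) subspace_orthogonal_comp)
  have pos: "0 < q \<bullet> (z *v q)" if "q \<in> W" "q \<noteq> 0" for q
  proof -
    have "q \<notin> N"
      using that orthogonal_Int_0[OF N] by (auto simp: W_def)
    then show ?thesis
      using that dual_psd_face(2)[OF assms, of q] by (auto simp: W_def N_def zero_set_def)
  qed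
  have "\<exists>c>0. \<forall>q\<in>W. c * (norm q)\<^sup>2 \<le> q \<bullet> (z *v q)"
  proof (cases "W \<inter> sphere 0 1 = {}")
    case True
    have "q = 0" if q: "q \<in> W" for q
    proof (rule ccontr)
      assume "q \<noteq> 0"
      then have "(1 / norm q) *\<^sub>R q \<in> W \<inter> sphere 0 1"
        using subspace_scale[OF W q] by simp
      with True show False by blast
    qed
    then have "\<forall>q\<in>W. 1 * (norm q)\<^sup>2 \<le> q \<bullet> (z *v q)" by fastforce
    then show ?thesis by (intro exI[of _ 1]) simp
  next
    case False
    have "compact (W \<inter> sphere 0 1)"
      using closed_subspace[OF W] by (simp add: closed_Int_compact)
    moreover have "continuous_on (W \<inter> sphere 0 1) (\<lambda>q. q \<bullet> (z *v q))"
      by (intro continuous_intros)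
    ultimately obtain u where u: "u \<in> W \<inter> sphere 0 1"
      "\<forall>q\<in>W \<inter> sphere 0 1. u \<bullet> (z *v u) \<le> q \<bullet> (z *v q)"
      using continuous_attains_inf[OF _ False] by blast
    have "(u \<bullet> (z *v u)) * (norm q)\<^sup>2 \<le> q \<bullet> (z *v q)" if q: "q \<in> W" for q
    proof (cases "q = 0")
      case False
      define s where "s = 1 / norm q"
      have "s *\<^sub>R q \<in> W \<inter> sphere 0 1"
        using subspace_scale[OF W q, of s] False by (simp add: s_def)
      then have "u \<bullet> (z *v u) \<le> (s *\<^sub>R q) \<bullet> (z *v (s *\<^sub>R q))" using u(2) by blast
      also have "\<dots> = (q \<bullet> (z *v q)) / (norm q)\<^sup>2"
        by (simp add: matrix_vector_mult_scaleR s_def power2_eq_square)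
      finally show ?thesis using False by (simp add: field_simps)
    qed simp
    moreover have "u \<noteq> 0" using u(1) by auto
    ultimately show ?thesis using pos[of u] u(1) by blast
  qed
  then obtain c where c: "c > 0" "\<And>q. q \<in> W \<Longrightarrow> c * (norm q)\<^sup>2 \<le> q \<bullet> (z *v q)" by blast
  show thesis
  proof (rule that[OF c(1)])
    fix u assume "u \<in> U"
    obtain p q where pq: "u = p + q" "p \<in> N" "\<And>y. y \<in> N \<Longrightarrow> y \<bullet> q = 0"
      using orthogonal_decomposition[OF N, of u] by blast
    then have "p \<in> U" by (simp add: N_def zero_set_def)
    then have "q \<in> U" using \<open>u \<in> U\<close> pq(1) subspace_diff[OF assms(1)] by fastforce
    then have "q \<in> W"
      using pq(3) by (simp add: W_def orthogonal_comp_def orthogonal_def)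
    \<comment> \<open>The mixed term vanishes, so the form at \<open>u\<close> equals the form at
      its orthogonal part \<open>q\<close>, where coercivity is available.\<close>
    have "p \<bullet> (z *v q) = 0"
      using zero_set_inner[OF assms pq(2)[unfolded N_def] \<open>q \<in> U\<close>] .
    then have "u \<bullet> (z *v u) = q \<bullet> (z *v q)"
      using quadratic_form_add[OF dual_psd_face(1)[OF assms], of q 1 p] pq(1,2)
      by (simp add: N_def zero_set_def add.commute)
    then show "\<exists>p q. u = p + q \<and> p \<in> zero_set U z \<and> p \<bullet> q = 0 \<and> c * (norm q)\<^sup>2 \<le> u \<bullet> (z *v u)"
      using c(2)[OF \<open>q \<in> W\<close>] pq by (auto simp: N_def)
  qed
qed

text \<open>The squared norms of the \<open>u i\<close> sum to the trace of \<open>X\<close>, hence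
  to O(norm X); by coercivity those of the discarded parts \<open>q i\<close> sum to O(e).
  Cauchy-Schwarz multiplies the two bounds under one root, whatever the number of summands.\<close>

lemma psd_face_residual:
  fixes U :: "(real^'n) set"
  assumes "subspace U" and "z \<in> dual_cone sym_mats (psd_face U)"
  obtains \<kappa> where "\<kappa> > 0"
    and "\<And>X e. \<lbrakk>X \<in> psd_face U; z \<bullet> X \<le> e\<rbrakk> \<Longrightarrow> infdist X (psd_face (zero_set U z)) \<le> \<kappa> * sqrt (norm X * e)"
proof -
  obtain c where c: "c > 0"
    and split: "\<And>u. u \<in> U \<Longrightarrow> \<exists>p q. u = p + q \<and> p \<in> zero_set U z \<and> p \<bullet> q = 0 \<and> c * (norm q)\<^sup>2 \<le> u \<bullet> (z *v u)"
    using zero_set_coercive[OF assms] by blast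
  \<comment> \<open>The trace is the inner product with the identity matrix, so \<open>M\<close>
    bounds it in terms of the norm.\<close>
  define M where "M = norm (mat 1 :: real^'n^'n)"
  show thesis
  proof
    show "2 * sqrt (M / c) + 1 > 0" using c by (simp add: M_def add_nonneg_pos)
    fix X :: "real^'n^'n" and e
    assume X: "X \<in> psd_face U" and e: "z \<bullet> X \<le> e"
    obtain m u where mu: "X = (\<Sum>i<m::nat. tens (u i) (u i))" "\<And>i. i < m \<Longrightarrow> u i \<in> U"
      using psd_face_decomposition[OF X] by blast
    then have "\<forall>i\<in>{..<m}. \<exists>p q. u i = p + q \<and> p \<in> zero_set U z \<and> p \<bullet> q = 0 \<and> c * (norm q)\<^sup>2 \<le> u i \<bullet> (z *v u i)"
      using split by simp
    then obtain p q where pq: "\<And>i. i < m \<Longrightarrow> u i = p i + q i" "\<And>i. i < m \<Longrightarrow> p i \<in> zero_set U z"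
      "\<And>i. i < m \<Longrightarrow> p i \<bullet> q i = 0" "\<And>i. i < m \<Longrightarrow> c * (norm (q i))\<^sup>2 \<le> u i \<bullet> (z *v u i)"
      by (metis lessThan_iff)
    define Y where "Y = (\<Sum>i<m. tens (p i) (p i))"
    have "Y \<in> psd_face (zero_set U z)"
      unfolding Y_def using pq(2) subspace_zero_set[OF assms] by (intro sum_tens_psd_face) auto
    have trace: "(\<Sum>i<m. (norm (u i))\<^sup>2) \<le> M * norm X"
    proof -
      have "(\<Sum>i<m. (norm (u i))\<^sup>2) = mat 1 \<bullet> X"
        by (simp add: mu(1) inner_commute[of "mat 1"] inner_sum_left inner_tens power2_norm_eq_inner)
      then show ?thesis unfolding M_def by (metis norm_cauchy_schwarz)
    qed
    have residue: "(\<Sum>i<m. (norm (q i))\<^sup>2) \<le> e / c"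
    proof -
      have "c * (\<Sum>i<m. (norm (q i))\<^sup>2) \<le> (\<Sum>i<m. u i \<bullet> (z *v u i))"
        unfolding sum_distrib_left using pq(4) by (intro sum_mono) auto
      also have "\<dots> = z \<bullet> X"
        by (simp add: mu(1) inner_commute[of z] inner_sum_left inner_tens)
      finally show ?thesis using e c by (simp add: field_simps)
    qed
    have "norm (X - Y) \<le> (\<Sum>i<m. 2 * (norm (u i) * norm (q i)))"
    proof -
      have "norm (tens (u i) (u i) - tens (p i) (p i)) \<le> 2 * (norm (u i) * norm (q i))" if "i < m" for i
      proof -
        \<comment> \<open>Each term on the right contains one factor \<open>q i\<close>, so the
          difference is linear, not quadratic, in the discarded part.\<close>
        have "tens (u i) (u i) - tens (p i) (p i) = tens (u i) (q i) + tens (q i) (p i)"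
          using pq(1)[OF that] by (simp add: tens_def vec_eq_iff algebra_simps)
        then have "norm (tens (u i) (u i) - tens (p i) (p i)) \<le> norm (u i) * norm (q i) + norm (q i) * norm (p i)"
          by (metis norm_tens norm_triangle_ineq)
        moreover have "norm (p i) \<le> norm (u i)"
        proof -
          have "(norm (p i + q i))\<^sup>2 = (norm (p i))\<^sup>2 + (norm (q i))\<^sup>2"
            using pq(3)[OF that] by (simp add: power2_norm_eq_inner inner_add inner_commute)
          then have "(norm (p i))\<^sup>2 \<le> (norm (p i + q i))\<^sup>2" by simp
          then show ?thesis unfolding pq(1)[OF that] by (rule power2_le_imp_le) simp
        qed
        ultimately show ?thesis using mult_left_mono[of "norm (p i)" "norm (u i)" "norm (q i)"] by (simp add: mult.commute)
      qed
      then show ?thesis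
        unfolding mu(1) Y_def sum_subtractf[symmetric] by (intro sum_norm_le) auto
    qed
    also have "\<dots> = 2 * (\<Sum>i<m. norm (u i) * norm (q i))" by (simp add: sum_distrib_left)
    also have "(\<Sum>i<m. norm (u i) * norm (q i)) \<le> sqrt ((\<Sum>i<m. (norm (u i))\<^sup>2) * (\<Sum>i<m. (norm (q i))\<^sup>2))"
      by (intro real_le_rsqrt Cauchy_Schwarz_ineq_sum)
    also have "\<dots> \<le> sqrt ((M * norm X) * (e / c))"
      using trace residue by (intro real_sqrt_le_mono mult_mono) (auto intro: sum_nonneg simp: M_def)
    also have "\<dots> = sqrt (M / c) * sqrt (norm X * e)"
      by (simp add: real_sqrt_mult[symmetric])
    finally have XY: "norm (X - Y) \<le> 2 * sqrt (M / c) * sqrt (norm X * e)" by simp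
    have "0 \<le> z \<bullet> X" using X assms(2) by (auto simp: dual_cone_def)
    then have "0 \<le> sqrt (norm X * e)" using e by simp
    then have "norm (X - Y) \<le> (2 * sqrt (M / c) + 1) * sqrt (norm X * e)"
      using XY unfolding distrib_right by linarith
    then show "infdist X (psd_face (zero_set U z)) \<le> (2 * sqrt (M / c) + 1) * sqrt (norm X * e)"
      using infdist_le[OF \<open>Y \<in> _\<close>, of X] by (simp add: dist_norm)
  qed
qed

section \<open>Error bounds along a facial reduction\<close>

text \<open>The normals are kept explicit because Farkas' lemma yields combinations of them.\<close>

definition poly_cone :: "'a::euclidean_space set \<Rightarrow> 'a set \<Rightarrow> 'a set" where
  "poly_cone V B = {x \<in> V. \<forall>b\<in>B. 0 \<le> b \<bullet> x}"

lemma polyhedron_poly_cone: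
  assumes "subspace V" and "finite B"
  shows "polyhedron (poly_cone V B)"
proof -
  have "poly_cone V B = V \<inter> \<Inter>((\<lambda>b. {x. b \<bullet> x \<ge> 0}) ` B)"
    by (auto simp: poly_cone_def)
  moreover have "polyhedron (\<Inter>((\<lambda>b. {x. b \<bullet> x \<ge> 0}) ` B))"
    using assms(2) by (intro polyhedron_Inter) (auto simp: polyhedron_halfspace_ge)
  ultimately show ?thesis
    using assms(1) by (simp add: affine_imp_polyhedron subspace_imp_affine polyhedron_Int)
qed

lemma convex_cone_poly_cone:
  assumes "subspace V"
  shows "convex_cone (poly_cone V B)"
  using assms unfolding convex_cone_iff poly_cone_def
  by (auto simp: subspace_0 subspace_add subspace_scale inner_add_right)

text \<open>A dual \<open>z\<close> is already nonnegative on the cone, so the equation amounts to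
  the single further inequality with normal \<open>- z\<close>.\<close>

lemma poly_cone_Int_orthogonal:
  assumes "z \<in> dual_cone V (poly_cone V B)"
  shows "poly_cone V B \<inter> {x. z \<bullet> x = 0} = poly_cone V (insert (- z) B)"
  using assms by (force simp: poly_cone_def dual_cone_def)

text \<open>Linear regularity of the cone and the hyperplane orthogonal to \<open>z\<close>; the
  distance to that hyperplane is \<open>\<bar>z \<bullet> x\<bar> / norm z\<close>.\<close>

lemma poly_cone_residual:
  fixes z :: "'a::euclidean_space"
  assumes "subspace V" and "finite B"
  obtains \<kappa> where "\<kappa> > 0"
    and "\<And>x. infdist x (poly_cone V B \<inter> {x. z \<bullet> x = 0}) \<le> \<kappa> * (infdist x (poly_cone V B) + \<bar>z \<bullet> x\<bar>)"
proof (cases "z = 0")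
  case True
  then show thesis by (intro that[of 1]) auto
next
  case False
  have "0 \<in> poly_cone V B \<inter> {x. z \<bullet> x = 0}"
    using convex_cone_contains_0[OF convex_cone_poly_cone[OF assms(1)]] by simp
  then obtain h where h: "h > 0"
    "\<And>x. infdist x (poly_cone V B \<inter> {x. z \<bullet> x = 0}) \<le> h * (infdist x (poly_cone V B) + infdist x {x. z \<bullet> x = 0})"
    using polyhedra_linearly_regular[OF polyhedron_poly_cone[OF assms] polyhedron_hyperplane[of z 0]] by blast
  have hyperplane: "infdist x {x. z \<bullet> x = 0} \<le> \<bar>z \<bullet> x\<bar> / norm z" for x
  proof -
    define y where "y = x - ((z \<bullet> x) / (z \<bullet> z)) *\<^sub>R z"
    have "z \<bullet> y = 0" using False by (simp add: y_def inner_diff_right)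
    moreover have "dist x y = \<bar>z \<bullet> x\<bar> / norm z"
      using False by (simp add: y_def dist_norm power2_norm_eq_inner[symmetric] power2_eq_square)
    ultimately show ?thesis by (intro infdist_le2[of y]) auto
  qed
  show thesis
  proof
    show "h * (1 + 1 / norm z) > 0" using h(1) by (simp add: add_pos_nonneg)
    fix x
    have "infdist x (poly_cone V B) + infdist x {x. z \<bullet> x = 0}
        \<le> infdist x (poly_cone V B) + \<bar>z \<bullet> x\<bar> / norm z"
      using hyperplane by simp
    also have "\<dots> \<le> (1 + 1 / norm z) * (infdist x (poly_cone V B) + \<bar>z \<bullet> x\<bar>)"
      using infdist_nonneg[of x "poly_cone V B"] by (simp add: algebra_simps)
    finally have "h * (infdist x (poly_cone V B) + infdist x {x. z \<bullet> x = 0})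
        \<le> h * ((1 + 1 / norm z) * (infdist x (poly_cone V B) + \<bar>z \<bullet> x\<bar>))"
      using h(1) by (intro mult_left_mono) auto
    then show "infdist x (poly_cone V B \<inter> {x. z \<bullet> x = 0}) \<le> h * (1 + 1 / norm z) * (infdist x (poly_cone V B) + \<bar>z \<bullet> x\<bar>)"
      using h(2)[of x] by (simp add: mult.assoc)
  qed
qed

section \<open>Cuts of a product cone\<close>

lemma dual_cone_TimesD:
  assumes "z \<in> dual_cone (V \<times> W) (G \<times> H)" and "0 \<in> G" and "0 \<in> H"
  shows "fst z \<in> dual_cone V G" and "snd z \<in> dual_cone W H"
  using assms by (force simp: dual_cone_def inner_prod_def)+

text \<open>Both components of \<open>z\<close> are nonnegative on their factors, so their sum
  vanishes only if both do. Hence a cut of the product is the product of two cuts.\<close>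

lemma Times_Int_orthogonal:
  assumes "z \<in> dual_cone (V \<times> W) (G \<times> H)" and "0 \<in> G" and "0 \<in> H"
  shows "(G \<times> H) \<inter> {z}\<^sup>\<bottom> = (G \<inter> {x. fst z \<bullet> x = 0}) \<times> (H \<inter> {x. snd z \<bullet> x = 0})"
proof -
  have "0 \<le> fst z \<bullet> g" "0 \<le> snd z \<bullet> h" if "g \<in> G" "h \<in> H" for g h
    using dual_cone_TimesD[OF assms] that by (auto simp: dual_cone_def)
  then show ?thesis
    by (force simp: orthogonal_comp_def orthogonal_def inner_prod_def add_nonneg_eq_0_iff)
qed

lemma infdist_Times:
  fixes A :: "'a::euclidean_space set" and B :: "'b::euclidean_space set"
  assumes "closed A" "A \<noteq> {}" "closed B" "B \<noteq> {}"
  shows "infdist (x, y) (A \<times> B) \<le> infdist x A + infdist y B"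
proof -
  obtain a where a: "a \<in> A" "infdist x A = dist x a"
    using infdist_attains_inf[OF assms(1,2)] by blast
  obtain b where b: "b \<in> B" "infdist y B = dist y b"
    using infdist_attains_inf[OF assms(3,4)] by blast
  have "infdist (x, y) (A \<times> B) \<le> dist (x, y) (a, b)"
    using a b by (intro infdist_le) simp
  also have "\<dots> \<le> dist x a + dist y b"
    by (simp add: dist_Pair_Pair sqrt_sum_squares_le_sum)
  finally show ?thesis using a b by simp
qed

text \<open>The class of cones that is preserved by reduction steps, starting from
  \<open>U = UNIV\<close> and the normals of \<open>nonneg_cone\<close>.\<close>

abbreviation dnn_face :: "(real^'n) set \<Rightarrow> (real^'n^'n) set \<Rightarrow> ((real^'n^'n) \<times> (real^'n^'n)) set" where
  "dnn_face U B \<equiv> psd_face U \<times> poly_cone sym_mats B"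

lemma
  assumes "subspace U"
  shows zero_in_psd_face: "0 \<in> psd_face U"
    and zero_in_poly_cone: "0 \<in> poly_cone sym_mats B"
  using assms by (simp_all add: convex_cone_contains_0 convex_cone_psd_face convex_cone_poly_cone subspace_sym_mats)

lemma
  assumes "subspace U" and "finite B"
  shows convex_cone_dnn_face: "convex_cone (dnn_face U B)"
    and closed_dnn_face: "closed (dnn_face U B)"
  using assms
  by (simp_all add: convex_cone_Times convex_cone_psd_face convex_cone_poly_cone subspace_sym_mats
      closed_Times closed_psd_face polyhedron_imp_closed polyhedron_poly_cone)

lemma dnn_face_step:
  assumes "subspace U" and "z \<in> dual_cone (sym_mats \<times> sym_mats) (dnn_face U B)"
  shows "dnn_face U B \<inter> {z}\<^sup>\<bottom> = dnn_face (zero_set U (fst z)) (insert (- snd z) B)"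
    and "subspace (zero_set U (fst z))" and "snd z \<in> sym_mats"
proof -
  note z = dual_cone_TimesD[OF assms(2) zero_in_psd_face zero_in_poly_cone, OF assms(1) assms(1)]
  show "dnn_face U B \<inter> {z}\<^sup>\<bottom> = dnn_face (zero_set U (fst z)) (insert (- snd z) B)"
    unfolding Times_Int_orthogonal[OF assms(2) zero_in_psd_face[OF assms(1)] zero_in_poly_cone[OF assms(1)]]
      psd_face_Int_orthogonal[OF assms(1) z(1)] poly_cone_Int_orthogonal[OF z(2)] ..
  show "subspace (zero_set U (fst z))" by (rule subspace_zero_set[OF assms(1) z(1)])
  show "snd z \<in> sym_mats" using z(2) by (simp add: dual_cone_def)
qed

text \<open>The semidefinite estimate is available only for points of the face, so \<open>x\<close>
  is first replaced by its projection \<open>p\<close>. There both components of \<open>z\<close>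
  are nonnegative, and a one-sided bound on \<open>z \<bullet> p\<close> controls each of
  them.\<close>

lemma dnn_face_residual:
  fixes U :: "(real^'n) set"
  assumes "subspace U" and "finite B" and "z \<in> dual_cone (sym_mats \<times> sym_mats) (dnn_face U B)"
  obtains \<kappa> where "\<kappa> > 0"
    and "\<And>x e. \<lbrakk>infdist x (dnn_face U B) \<le> e; z \<bullet> x \<le> e\<rbrakk>
      \<Longrightarrow> infdist x (dnn_face U B \<inter> {z}\<^sup>\<bottom>) \<le> \<kappa> * (e + sqrt (norm x * e))"
proof -
  define F where "F = dnn_face U B"
  define G' where "G' = psd_face (zero_set U (fst z))"
  define H' where "H' = poly_cone sym_mats B \<inter> {x. snd z \<bullet> x = 0}"
  note z = dual_cone_TimesD[OF assms(3) zero_in_psd_face zero_in_poly_cone, OF assms(1) assms(1)]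
  have FG: "F \<inter> {z}\<^sup>\<bottom> = G' \<times> H'"
    unfolding F_def G'_def H'_def Times_Int_orthogonal[OF assms(3) zero_in_psd_face[OF assms(1)] zero_in_poly_cone[OF assms(1)]]
      psd_face_Int_orthogonal[OF assms(1) z(1)] ..
  obtain k1 where k1: "k1 > 0" "\<And>X e. \<lbrakk>X \<in> psd_face U; fst z \<bullet> X \<le> e\<rbrakk> \<Longrightarrow> infdist X G' \<le> k1 * sqrt (norm X * e)"
    using psd_face_residual[OF assms(1) z(1)] unfolding G'_def by blast
  obtain k2 where k2: "k2 > 0"
    "\<And>x. infdist x H' \<le> k2 * (infdist x (poly_cone sym_mats B) + \<bar>snd z \<bullet> x\<bar>)"
    using poly_cone_residual[OF subspace_sym_mats assms(2)] unfolding H'_def by blast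
  have closed: "closed G'" "closed H'"
    unfolding G'_def H'_def
    by (intro closed_psd_face subspace_zero_set[OF assms(1) z(1)] closed_Int closed_hyperplane
        polyhedron_imp_closed polyhedron_poly_cone subspace_sym_mats assms(2))+
  have nonempty: "G' \<noteq> {}" "H' \<noteq> {}"
    using zero_in_psd_face[OF subspace_zero_set[OF assms(1) z(1)]] zero_in_poly_cone[OF assms(1), of B]
    unfolding G'_def H'_def by auto
  define m where "m = 1 + norm z"
  have "m \<ge> 1" by (simp add: m_def)
  define k where "k = 1 + k1 * sqrt m + k2 * m"
  have F: "closed F" "convex F" "0 \<in> F"
    using closed_dnn_face[OF assms(1,2)] convex_cone_dnn_face[OF assms(1,2)]
      convex_cone_contains_0[OF convex_cone_dnn_face[OF assms(1,2)]]
    unfolding F_def convex_cone_def by blast+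
  show thesis
  proof
    show "k > 0" unfolding k_def using k1 k2 \<open>m \<ge> 1\<close> by (simp add: add_pos_pos)
    fix x e assume x: "infdist x (dnn_face U B) \<le> e" "z \<bullet> x \<le> e"
    have "0 \<le> e" using x(1) infdist_nonneg order_trans by blast
    define p where "p = closest_point F x"
    have p: "p \<in> F" unfolding p_def using F by (intro closest_point_in_set) auto
    have "dist x p = infdist x F"
      unfolding p_def infdist_eq_setdist using F(1,3) by (subst setdist_closest_point) auto
    then have xp: "dist x p \<le> e" using x(1) by (simp add: F_def)
    \<comment> \<open>Projection fixes the origin and is nonexpansive, so it does not increase the
      norm.\<close>
    have "dist (closest_point F x) (closest_point F 0) \<le> dist x 0"
      using F by (intro closest_point_lipschitz) auto
    then have norm_p: "norm p \<le> norm x"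
      using F(3) by (simp add: p_def closest_point_self)
    have p12: "fst p \<in> psd_face U" "snd p \<in> poly_cone sym_mats B" using p by (auto simp: F_def)
    have nonneg: "0 \<le> fst z \<bullet> fst p" "0 \<le> snd z \<bullet> snd p"
      using z p12 by (auto simp: dual_cone_def)
    have "z \<bullet> p = z \<bullet> x + z \<bullet> (p - x)" by (simp add: inner_diff_right)
    also have "\<dots> \<le> e + norm z * norm (p - x)"
      using x(2) norm_cauchy_schwarz by (intro add_mono) auto
    also have "\<dots> \<le> e + norm z * e"
      using xp by (intro add_left_mono mult_left_mono) (auto simp: dist_norm norm_minus_commute)
    finally have "z \<bullet> p \<le> m * e" by (simp add: m_def algebra_simps)
    then have zp: "fst z \<bullet> fst p \<le> m * e" "snd z \<bullet> snd p \<le> m * e"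
      using nonneg by (auto simp: inner_prod_def)
    have "infdist (fst p) G' \<le> k1 * sqrt (norm (fst p) * (m * e))"
      by (rule k1(2)[OF p12(1) zp(1)])
    also have "\<dots> \<le> k1 * sqrt (norm x * (m * e))"
      using k1(1) norm_fst_le[of "fst p" "snd p"] norm_p \<open>m \<ge> 1\<close> \<open>0 \<le> e\<close>
      by (intro mult_left_mono real_sqrt_le_mono mult_right_mono) auto
    also have "\<dots> = k1 * sqrt m * sqrt (norm x * e)"
      by (simp add: real_sqrt_mult)
    finally have 1: "infdist (fst p) G' \<le> k1 * sqrt m * sqrt (norm x * e)" .
    have "infdist (snd p) H' \<le> k2 * (0 + \<bar>snd z \<bullet> snd p\<bar>)"
      using k2(2)[of "snd p"] p12(2) by simp
    also have "\<dots> \<le> k2 * (m * e)"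
      using zp nonneg k2(1) by (intro mult_left_mono) auto
    finally have 2: "infdist (snd p) H' \<le> k2 * m * e" by simp
    have "infdist x (F \<inter> {z}\<^sup>\<bottom>) \<le> infdist p (G' \<times> H') + dist x p"
      unfolding FG by (rule infdist_triangle)
    also have "\<dots> \<le> (k1 * sqrt m * sqrt (norm x * e) + k2 * m * e) + e"
      using infdist_Times[OF closed(1) nonempty(1) closed(2) nonempty(2), of "fst p" "snd p"] 1 2 xp by simp
    also have "\<dots> \<le> k * (e + sqrt (norm x * e))"
    proof -
      have "0 \<le> sqrt (norm x * e)" "0 \<le> k1 * sqrt m * e" "0 \<le> k2 * m * sqrt (norm x * e)"
        using \<open>0 \<le> e\<close> k1 k2 \<open>m \<ge> 1\<close> by auto
      then show ?thesis unfolding k_def by (simp add: algebra_simps)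
    qed
    finally show "infdist x (dnn_face U B \<inter> {z}\<^sup>\<bottom>) \<le> k * (e + sqrt (norm x * e))"
      by (simp add: F_def)
  qed
qed

section \<open>Sums of Hoelder terms\<close>

text \<open>The term for \<open>j = 0\<close> stands apart because \<open>0 powr 0\<close> is 0: the
  general formula would lose the summand \<open>e\<close> at \<open>r = 0\<close>.\<close>

definition holder_sum :: "real \<Rightarrow> real \<Rightarrow> nat \<Rightarrow> real" where
  "holder_sum e r k = e + (\<Sum>j = 1..k. e powr (1 / 2 ^ j) * r powr (1 - 1 / 2 ^ j))"

text \<open>The two exponents of each term add up to 1. This later extracts the factor 2 caused by
  passing from \<open>x\<close> to \<open>(x, x)\<close>.\<close>

lemma holder_sum_scale:
  assumes "0 \<le> e" and "0 \<le> r" and "0 < c"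
  shows "holder_sum (c * e) (c * r) k = c * holder_sum e r k"
proof -
  have "c powr s * c powr (1 - s) = c" for s
    using assms(3) by (simp add: powr_add[symmetric])
  then have "(c * e) powr s * (c * r) powr (1 - s) = c * (e powr s * r powr (1 - s))" for s
    using assms by (simp add: powr_mult mult_ac)
  then show ?thesis by (simp add: holder_sum_def distrib_left sum_distrib_left)
qed

lemma le_holder_sum: "e \<le> holder_sum e r k"
  unfolding holder_sum_def by (simp add: sum_nonneg)

text \<open>The square root is subadditive, and the root of \<open>r\<close> times the j-th term is
  the term with index j + 1.\<close>

lemma sqrt_holder_sum:
  assumes "0 \<le> e" and "0 \<le> r"
  shows "sqrt (r * holder_sum e r k) \<le> (\<Sum>j = 1..Suc k. e powr (1 / 2 ^ j) * r powr (1 - 1 / 2 ^ j))"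
proof (induction k)
  case 0
  then show ?case
    using assms by (simp add: holder_sum_def powr_half_sqrt real_sqrt_mult)
next
  case (Suc k)
  define t where "t = e powr (1 / 2 ^ Suc k) * r powr (1 - 1 / 2 ^ Suc k)"
  have half: "(x powr s) powr (1 / 2) = x powr (s / 2)" for x s :: real
    by (simp add: powr_powr)
  have "sqrt (r * t) = (r * t) powr (1 / 2)"
    using assms by (simp add: t_def powr_half_sqrt)
  also have "\<dots> = e powr (1 / 2 ^ Suc k / 2) * (r powr (1 / 2) * r powr ((1 - 1 / 2 ^ Suc k) / 2))"
    using assms by (simp add: t_def powr_mult half)
  also have "r powr (1 / 2) * r powr ((1 - 1 / 2 ^ Suc k) / 2) = r powr (1 - 1 / 2 ^ Suc (Suc k))"
    unfolding powr_add[symmetric] by (intro arg_cong[of _ _ "\<lambda>s. r powr s"]) (simp add: field_simps)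
  finally have t: "sqrt (r * t) = e powr (1 / 2 ^ Suc (Suc k)) * r powr (1 - 1 / 2 ^ Suc (Suc k))"
    by simp
  have "sqrt (r * holder_sum e r (Suc k)) = sqrt (r * holder_sum e r k + r * t)"
    by (simp add: holder_sum_def t_def algebra_simps)
  also have "\<dots> \<le> sqrt (r * holder_sum e r k) + sqrt (r * t)"
    using assms le_holder_sum[of e r k] by (intro sqrt_add_le_add_sqrt) (auto simp: t_def)
  finally show ?case using Suc t by simp
qed

lemma holder_sum_step:
  assumes "0 \<le> e" and "0 \<le> r"
  shows "holder_sum e r k + sqrt (r * holder_sum e r k) \<le> 2 * holder_sum e r (Suc k)"
proof -
  have "holder_sum e r k \<le> holder_sum e r (Suc k)"
    by (simp add: holder_sum_def)
  moreover have "sqrt (r * holder_sum e r k) \<le> holder_sum e r (Suc k)"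
    using sqrt_holder_sum[OF assms, of k] assms(1) unfolding holder_sum_def[of e r "Suc k"] by linarith
  ultimately show ?thesis by simp
qed

text \<open>Shape and estimate go through one induction, because the constant of a step depends on
  the face reached so far. A bound \<open>r\<close> replaces the norm so that
  \<open>2 * norm x\<close> can be inserted for the pair \<open>(x, x)\<close>.\<close>

lemma reduced_dnn_face:
  fixes U :: "(real^'n) set" and M :: "((real^'n^'n) \<times> (real^'n^'n)) set"
  assumes "subspace U" and "finite B"
    and "subspace M" and "reducing_directions (sym_mats \<times> sym_mats) (dnn_face U B) M b k z"
  shows "(\<exists>U' B'. subspace U' \<and> finite B' \<and> reduced_cone (dnn_face U B) z k = dnn_face U' B') \<and>
    (\<exists>\<kappa>>0. \<forall>x e r. infdist x (dnn_face U B) \<le> e \<and> infdist x ((+) b ` M) \<le> e \<and> norm x \<le> r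
      \<longrightarrow> infdist x (reduced_cone (dnn_face U B) z k) \<le> \<kappa> * holder_sum e r k)"
  using assms(4)
proof (induction k)
  case 0
  have "infdist x (dnn_face U B) \<le> 1 * holder_sum e r 0" if "infdist x (dnn_face U B) \<le> e" for x e r
    using that by (simp add: holder_sum_def)
  then show ?case using assms(1,2) by (auto intro!: exI[of _ "1::real"])
next
  case (Suc k)
  define A where "A = (+) b ` M"
  have A: "closed A" "A \<noteq> {}"
    using subspace_0[OF assms(3)] closed_subspace[OF assms(3)] by (auto simp: A_def closed_translation)
  have "reducing_directions (sym_mats \<times> sym_mats) (dnn_face U B) M b k z"
    using Suc.prems by (simp add: reducing_directions_def)
  from Suc.IH[OF this] obtain U' B' \<kappa> where U': "subspace U'" "finite B'"
      "reduced_cone (dnn_face U B) z k = dnn_face U' B'"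
    and \<kappa>: "\<kappa> > 0" "\<And>x e r. \<lbrakk>infdist x (dnn_face U B) \<le> e; infdist x A \<le> e; norm x \<le> r\<rbrakk>
      \<Longrightarrow> infdist x (dnn_face U' B') \<le> \<kappa> * holder_sum e r k"
    unfolding A_def by auto
  have z: "z k \<in> dual_cone (sym_mats \<times> sym_mats) (dnn_face U' B')"
      "z k \<in> orth_compl (sym_mats \<times> sym_mats) M" "z k \<in> orth_compl (sym_mats \<times> sym_mats) {b}"
    using Suc.prems U'(3) by (auto simp: reducing_directions_def)
  \<comment> \<open>The direction vanishes on the whole affine space, so its value at
    \<open>x\<close> is controlled by the distance from \<open>x\<close> to that space.\<close>
  have zA: "z k \<bullet> y = 0" if "y \<in> A" for y
    using that z(2,3) by (auto simp: A_def orth_compl_def orthogonal_comp_def orthogonal_def inner_commute inner_add_right)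
  obtain h where h: "h > 0" "\<And>x e. \<lbrakk>infdist x (dnn_face U' B') \<le> e; z k \<bullet> x \<le> e\<rbrakk>
      \<Longrightarrow> infdist x (dnn_face U' B' \<inter> {z k}\<^sup>\<bottom>) \<le> h * (e + sqrt (norm x * e))"
    using dnn_face_residual[OF U'(1,2) z(1)] by blast
  \<comment> \<open>One factor for both inputs of the next cut: \<open>\<kappa>\<close> for the
    distance to the current face, \<open>norm (z k)\<close> for the value of
    \<open>z k\<close>.\<close>
  define c where "c = \<kappa> + norm (z k)"
  have "c > 0" using \<kappa>(1) by (simp add: c_def add_pos_nonneg)
  have step: "infdist x (dnn_face U' B' \<inter> {z k}\<^sup>\<bottom>) \<le> (2 * h * (c + sqrt c)) * holder_sum e r (Suc k)"
    if x: "infdist x (dnn_face U B) \<le> e" "infdist x A \<le> e" "norm x \<le> r" for x e r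
  proof -
    have "0 \<le> e" using x(1) infdist_nonneg order_trans by blast
    have "0 \<le> r" using x(3) norm_ge_zero order_trans by blast
    define T where "T = holder_sum e r k"
    have "e \<le> T" unfolding T_def by (rule le_holder_sum)
    have "z k \<bullet> x \<le> norm (z k) * e"
    proof -
      obtain y where y: "y \<in> A" "infdist x A = dist x y"
        using infdist_attains_inf[OF A, of x] by blast
      then have "z k \<bullet> x \<le> norm (z k) * dist x y"
        using zA[OF y(1)] norm_cauchy_schwarz[of "z k" "x - y"] by (simp add: inner_diff_right dist_norm)
      also have "\<dots> \<le> norm (z k) * e"
        using x(2) y(2) by (intro mult_left_mono) auto
      finally show ?thesis .
    qed
    also have "\<dots> \<le> norm (z k) * T" using \<open>e \<le> T\<close> by (intro mult_left_mono) auto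
    also have "\<dots> \<le> c * T" using \<kappa>(1) \<open>0 \<le> e\<close> \<open>e \<le> T\<close> by (intro mult_right_mono) (auto simp: c_def)
    finally have zx: "z k \<bullet> x \<le> c * T" .
    have "infdist x (dnn_face U' B') \<le> \<kappa> * T" unfolding T_def by (rule \<kappa>(2)[OF x])
    also have "\<dots> \<le> c * T" using \<open>0 \<le> e\<close> \<open>e \<le> T\<close> by (intro mult_right_mono) (auto simp: c_def)
    finally have "infdist x (dnn_face U' B' \<inter> {z k}\<^sup>\<bottom>) \<le> h * (c * T + sqrt (norm x * (c * T)))"
      using zx by (rule h(2))
    also have "\<dots> \<le> h * (c * T + sqrt (r * (c * T)))"
      using h(1) x(3) \<open>c > 0\<close> \<open>0 \<le> e\<close> \<open>e \<le> T\<close>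
      by (intro mult_left_mono add_left_mono real_sqrt_le_mono mult_right_mono) auto
    also have "\<dots> = h * (c * T + sqrt c * sqrt (r * T))"
      by (simp add: real_sqrt_mult mult_ac)
    also have "\<dots> \<le> h * ((c + sqrt c) * (T + sqrt (r * T)))"
      using h(1) \<open>c > 0\<close> \<open>0 \<le> r\<close> \<open>0 \<le> e\<close> \<open>e \<le> T\<close>
      by (intro mult_left_mono) (auto simp: algebra_simps)
    also have "\<dots> \<le> h * ((c + sqrt c) * (2 * holder_sum e r (Suc k)))"
      unfolding T_def using h(1) \<open>c > 0\<close>
      by (intro mult_left_mono holder_sum_step \<open>0 \<le> e\<close> \<open>0 \<le> r\<close>) auto
    finally show ?thesis by (simp add: algebra_simps)
  qed
  have "2 * h * (c + sqrt c) > 0" using h(1) \<open>c > 0\<close> by (simp add: add_pos_pos)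
  moreover have "subspace (zero_set U' (fst (z k)))" "finite (insert (- snd (z k)) B')"
    "reduced_cone (dnn_face U B) z (Suc k) = dnn_face (zero_set U' (fst (z k))) (insert (- snd (z k)) B')"
    using dnn_face_step[OF U'(1) z(1)] U' by simp_all
  ultimately show ?case
    using step unfolding A_def reduced_cone.simps U'(3) by blast
qed

section \<open>Existence of short facial reductions\<close>

text \<open>The hypothesis makes \<open>- w\<close> nonnegative on the directions in
  \<open>L\<close> and \<open>M\<close> that are feasible at \<open>q\<close>. The cone dual to
  these is generated by the normals active at \<open>q\<close> and the two orthogonal complements;
  being finitely generated, it is closed, so separation needs no interior point.\<close>

lemma farkas_at_point:
  fixes w q :: "'a::euclidean_space"
  assumes "subspace V" and "finite B" and "B \<subseteq> V" and "q \<in> poly_cone V B"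
    and "subspace L" and "L \<subseteq> V" and "subspace M"
    and w: "\<And>d. d \<in> L \<Longrightarrow> d \<in> M \<Longrightarrow> q + d \<in> poly_cone V B \<Longrightarrow> w \<bullet> d \<le> 0"
  obtains v l g where "- w = v + l + g" and "v \<in> dual_cone V (poly_cone V B)" and "v \<bullet> q = 0"
    and "\<And>y. y \<in> L \<Longrightarrow> l \<bullet> y = 0" and "\<And>y. y \<in> M \<Longrightarrow> g \<bullet> y = 0"
proof -
  define B0 where "B0 = {b \<in> B. b \<bullet> q = 0}"
  obtain DL where DL: "finite DL" "span DL = L\<^sup>\<bottom>"
    by (metis basis_exists independent_imp_finite span_eq_iff subset_antisym span_minimal subspace_orthogonal_comp)
  obtain DM where DM: "finite DM" "span DM = M\<^sup>\<bottom>"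
    by (metis basis_exists independent_imp_finite span_eq_iff subset_antisym span_minimal subspace_orthogonal_comp)
  \<comment> \<open>A basis together with its negatives generates the orthogonal complement as a
    cone, so that \<open>K\<close> has finitely many generators.\<close>
  define KL where "KL = convex_cone hull (DL \<union> uminus ` DL)"
  define KM where "KM = convex_cone hull (DM \<union> uminus ` DM)"
  define K where "K = convex_cone hull (B0 \<union> (DL \<union> uminus ` DL) \<union> (DM \<union> uminus ` DM))"
  have "finite B0" using assms(2) by (simp add: B0_def)
  then have "closed K"
    unfolding K_def using DL(1) DM(1) by (intro closed_convex_cone_hull) simp
  have K_cone: "convex_cone K" unfolding K_def by (rule convex_cone_convex_cone_hull)
  have hullK: "x \<in> K" if "x \<in> B0 \<union> (DL \<union> uminus ` DL) \<union> (DM \<union> uminus ` DM)" for x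
    unfolding K_def using that by (rule hull_inc)
  have "- w \<in> K"
  proof (rule ccontr)
    assume "- w \<notin> K"
    then obtain a' b' where sep: "(a' - (- w)) \<bullet> (- w) < b'" "\<And>x. x \<in> K \<Longrightarrow> b' < (a' - (- w)) \<bullet> x"
      using separating_hyperplane_closed_point_inset[of K "- w"] \<open>closed K\<close> K_cone
      by (metis convex_cone_def)
    define d where "d = a' + w"
    have "b' < 0" using sep(2)[OF convex_cone_contains_0[OF K_cone]] by simp
    \<comment> \<open>A functional bounded below on a cone is nonnegative there: a negative value
      could be rescaled to \<open>b'\<close> itself.\<close>
    have dK: "0 \<le> d \<bullet> x" if "x \<in> K" for x
    proof (rule ccontr)
      assume "\<not> 0 \<le> d \<bullet> x"
      then have neg: "d \<bullet> x < 0" by simp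
      have "(b' / (d \<bullet> x)) *\<^sub>R x \<in> K"
        using convex_cone_scaleR[OF K_cone _ that] neg \<open>b' < 0\<close> by (simp add: divide_nonpos_neg)
      then have "b' < (a' - (- w)) \<bullet> ((b' / (d \<bullet> x)) *\<^sub>R x)" by (rule sep(2))
      then have "b' < d \<bullet> ((b' / (d \<bullet> x)) *\<^sub>R x)" unfolding d_def by simp
      then show False using neg by simp
    qed
    \<comment> \<open>Being nonnegative on generators and on their negatives, \<open>d\<close> is
      orthogonal to them, so it lies in the double complement \<open>W\<close>.\<close>
    have span_0: "d \<in> W" if "subspace W" "span D = W\<^sup>\<bottom>" "\<And>x. x \<in> D \<union> uminus ` D \<Longrightarrow> x \<in> K" for W D
    proof -
      have "d \<bullet> x = 0" if "x \<in> D" for x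
        using dK[of x] dK[of "- x"] \<open>\<And>x. x \<in> D \<union> uminus ` D \<Longrightarrow> x \<in> K\<close> that by fastforce
      then have "orthogonal d y" if "y \<in> span D" for y
        using that by (intro orthogonal_to_span[of y D]) (auto simp: orthogonal_def)
      then have "d \<in> W\<^sup>\<bottom>\<^sup>\<bottom>"
        using that(2) by (simp add: orthogonal_comp_def orthogonal_commute)
      then show ?thesis using orthogonal_comp_self[OF that(1)] by simp
    qed
    have "d \<in> L" using span_0[OF assms(5) DL(2)] hullK by blast
    have "d \<in> M" using span_0[OF assms(7) DM(2)] hullK by blast
    have q: "q \<in> V" "\<And>b. b \<in> B \<Longrightarrow> 0 \<le> b \<bullet> q" using assms(4) by (auto simp: poly_cone_def)
    \<comment> \<open>Normals active at \<open>q\<close> belong to \<open>K\<close> and are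
      nonnegative on \<open>d\<close>; the others have positive slack at \<open>q\<close>.\<close>
    have "\<exists>t>0. \<forall>b\<in>B. 0 \<le> b \<bullet> q + t * (b \<bullet> d)"
    proof (rule small_step_nonneg[OF assms(2), of "\<lambda>b. b \<bullet> q" "\<lambda>b. b \<bullet> d"])
      show "0 \<le> b \<bullet> d" if "b \<in> B" "b \<bullet> q = 0" for b
        using dK[OF hullK, of b] that by (simp add: B0_def inner_commute)
    qed (use q in auto)
    then obtain t where t: "t > 0" "\<forall>b\<in>B. 0 \<le> b \<bullet> q + t * (b \<bullet> d)" by blast
    then have "q + t *\<^sub>R d \<in> poly_cone V B"
      using q(1) \<open>d \<in> L\<close> assms(1,6)
      by (auto simp: poly_cone_def inner_add_right intro!: subspace_add subspace_scale)
    then have "w \<bullet> (t *\<^sub>R d) \<le> 0"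
      using \<open>d \<in> L\<close> \<open>d \<in> M\<close> assms(5,7) by (intro w subspace_scale)
    then have "w \<bullet> d \<le> 0" using t(1) by (simp add: mult_le_0_iff)
    moreover have "d \<bullet> (- w) < 0" using sep(1) \<open>b' < 0\<close> by (simp add: d_def)
    ultimately show False by (simp add: inner_commute)
  qed
  then obtain v l g where vlg: "- w = v + l + g" "v \<in> convex_cone hull B0" "l \<in> KL" "g \<in> KM"
    unfolding K_def convex_cone_hull_Un[of "B0 \<union> (DL \<union> uminus ` DL)"] convex_cone_hull_Un[of B0] KL_def KM_def
    by blast
  have ortho: "x \<bullet> y = 0" if "span D = W\<^sup>\<bottom>" "x \<in> convex_cone hull (D \<union> uminus ` D)" "y \<in> W" for x y W D
  proof -
    have "D \<union> uminus ` D \<subseteq> span D" by (auto intro: span_base span_neg)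
    then have "convex_cone hull (D \<union> uminus ` D) \<subseteq> span D"
      by (intro hull_minimal convex_cone_span)
    then show ?thesis using that by (auto simp: orthogonal_comp_def orthogonal_def inner_commute)
  qed
  have "convex_cone hull B0 \<subseteq> {x \<in> dual_cone V (poly_cone V B). x \<bullet> q = 0}"
  proof (rule hull_minimal)
    show "B0 \<subseteq> {x \<in> dual_cone V (poly_cone V B). x \<bullet> q = 0}"
      using assms(3) by (auto simp: B0_def dual_cone_def poly_cone_def)
    show "convex_cone {x \<in> dual_cone V (poly_cone V B). x \<bullet> q = 0}"
      using assms(1) unfolding convex_cone_iff dual_cone_def
      by (auto simp: subspace_0 subspace_add subspace_scale inner_add_left)
  qed
  then have "v \<in> dual_cone V (poly_cone V B)" "v \<bullet> q = 0" using vlg(2) by auto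
  then show thesis
    using vlg(1) ortho[OF DL(2), of l] ortho[OF DM(2), of g] vlg(3,4)
    unfolding KL_def KM_def by (intro that)
qed

text \<open>
  Rockafellar's separation of a convex set from a polyhedron: the separating functional may be taken
  in \<open>span G\<close>, so it does not vanish on \<open>G\<close>, and the polyhedral side is handled by Farkas' lemma at
  the common point \<open>q\<close>.
\<close>

lemma polyhedral_alternative:
  fixes G :: "'a::euclidean_space set"
  assumes V: "subspace V" and B: "finite B" "B \<subseteq> V" and G: "convex_cone G" "G \<subseteq> V"
    and L: "subspace L" "L \<subseteq> V" and q: "q \<in> G \<inter> poly_cone V B \<inter> (+) a ` L"
    and disj: "rel_interior G \<inter> poly_cone V B \<inter> (+) a ` L = {}"
  obtains z1 z2 where "z1 \<in> dual_cone V G" and "z2 \<in> dual_cone V (poly_cone V B)"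
    and "\<And>y. y \<in> L \<Longrightarrow> (z1 + z2) \<bullet> y = 0" and "(z1 + z2) \<bullet> a = 0" and "\<exists>g\<in>G. z1 \<bullet> g \<noteq> 0"
proof -
  have convG: "convex G" "G \<noteq> {}" using G(1) by (auto simp: convex_cone_def)
  \<comment> \<open>Intersecting with \<open>span G\<close> keeps all differences inside
    \<open>span G\<close>, which forces \<open>w\<close> into it.\<close>
  define D where "D = poly_cone V B \<inter> (+) a ` L \<inter> span G"
  have "affine ((+) a ` L)" using L(1) by (metis affine_translation subspace_imp_affine)
  then have "convex ((+) a ` L)" by (rule affine_imp_convex)
  moreover have "convex (poly_cone V B)"
    by (rule polyhedron_imp_convex[OF polyhedron_poly_cone[OF V B(1)]])
  ultimately have "convex D"
    unfolding D_def by (intro convex_Int) (simp_all add: subspace_imp_convex)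
  have "q \<in> D" using q by (auto simp: D_def span_base)
  define S where "S = {g - d |g d. g \<in> rel_interior G \<and> d \<in> D}"
  have "S = (\<Union>x\<in>rel_interior G. \<Union>y\<in>D. {x - y})" by (auto simp: S_def)
  then have "convex S"
    using convex_differences[OF convex_rel_interior[OF convG(1)] \<open>convex D\<close>] by simp
  moreover have "S \<noteq> {}"
    using rel_interior_eq_empty[OF convG(1)] convG(2) \<open>q \<in> D\<close> by (auto simp: S_def)
  moreover have "0 \<notin> S" using disj by (auto simp: S_def D_def)
  ultimately obtain w where w: "w \<in> span S" "w \<noteq> 0" "\<And>x. x \<in> S \<Longrightarrow> 0 \<le> w \<bullet> x"
    using separating_hyperplane_set_0_inspan by metis
  have "S \<subseteq> span G"
    using rel_interior_subset[of G] by (auto simp: S_def D_def intro!: span_diff intro: span_base)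
  then have "w \<in> span G" using w(1) by (metis span_minimal subspace_span subsetD)
  have sep: "w \<bullet> d \<le> w \<bullet> g" if "g \<in> G" "d \<in> D" for g d
  proof -
    have "rel_interior G \<subseteq> {x. w \<bullet> x \<ge> w \<bullet> d}"
      using w(3) that(2) by (force simp: S_def inner_diff_right)
    \<comment> \<open>The inequality passes from the relative interior to all of \<open>G\<close>,
      which lies in its closure.\<close>
    then have "closure (rel_interior G) \<subseteq> {x. w \<bullet> x \<ge> w \<bullet> d}"
      by (intro closure_minimal closed_halfspace_ge)
    then show ?thesis
      using that(1) convex_closure_rel_interior[OF convG(1)] closure_subset by blast
  qed
  have wG: "0 \<le> w \<bullet> g" if "g \<in> G" for g
  proof (rule ccontr)
    assume "\<not> 0 \<le> w \<bullet> g"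
    then have neg: "w \<bullet> g < 0" by simp
    \<comment> \<open>Scales \<open>g\<close> so that \<open>w\<close> takes the value
      \<open>- (\<bar>w \<bullet> q\<bar> + 1)\<close>, below \<open>w \<bullet> q\<close>.\<close>
    define t where "t = (\<bar>w \<bullet> q\<bar> + 1) / (- (w \<bullet> g))"
    have "t *\<^sub>R g \<in> G"
      using neg by (intro convex_cone_scaleR[OF G(1) _ that]) (simp add: t_def divide_nonneg_neg)
    then have "w \<bullet> q \<le> w \<bullet> (t *\<^sub>R g)" using \<open>q \<in> D\<close> by (rule sep)
    also have "\<dots> = - (\<bar>w \<bullet> q\<bar> + 1)" using neg by (simp add: t_def)
    finally show False by linarith
  qed
  have wD: "w \<bullet> d \<le> 0" if "d \<in> D" for d
    using sep[OF convex_cone_contains_0[OF G(1)] that] by simp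
  have wq: "w \<bullet> q = 0" using wG[of q] wD[OF \<open>q \<in> D\<close>] q by force
  have "w \<bullet> d \<le> 0" if "d \<in> L" "d \<in> span G" "q + d \<in> poly_cone V B" for d
  proof -
    obtain l where "l \<in> L" "q = a + l" using q by auto
    then have "q + d \<in> (+) a ` L"
      using that(1) L(1) by (auto simp: add.assoc intro!: imageI subspace_add)
    moreover have "q + d \<in> span G" using that(2) q by (intro span_add) (auto intro: span_base)
    ultimately have "q + d \<in> D" using that(3) by (simp add: D_def)
    then show ?thesis using wD[of "q + d"] wq by (simp add: inner_add_right)
  qed
  then obtain v l g where vlg: "- w = v + l + g" "v \<in> dual_cone V (poly_cone V B)" "v \<bullet> q = 0"
    and l: "\<And>y. y \<in> L \<Longrightarrow> l \<bullet> y = 0" and g: "\<And>y. y \<in> span G \<Longrightarrow> g \<bullet> y = 0"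
    using farkas_at_point[OF V B _ L subspace_span[of G], where q = q and w = w] q by blast
  obtain g1 g2 where g12: "g = g1 + g2" "g1 \<in> V" "\<And>y. y \<in> V \<Longrightarrow> y \<bullet> g2 = 0"
    using orthogonal_decomposition[OF V, of g] by blast
  \<comment> \<open>Farkas' lemma leaves a part \<open>g\<close> that is orthogonal to
    \<open>span G\<close> but may leave \<open>V\<close>. Its component \<open>g1\<close> in
    \<open>V\<close> joins \<open>w\<close>, which changes nothing on \<open>G\<close>; the rest
    \<open>g2\<close> vanishes on \<open>V\<close> and so on \<open>L\<close>.\<close>
  define z1 where "z1 = w + g1"
  have "w \<in> V" using \<open>w \<in> span G\<close> G(2) V by (metis span_minimal subsetD)
  have z1_span: "z1 \<bullet> y = w \<bullet> y" if "y \<in> G" for y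
  proof -
    have "g2 \<bullet> y = 0" using g12(3)[of y] that G(2) by (auto simp: inner_commute)
    then have "g1 \<bullet> y = 0"
      using g[of y] that by (simp add: g12(1) inner_add_left span_base)
    then show ?thesis by (simp add: z1_def inner_add_left)
  qed
  have sum: "z1 + v = - l - g2"
  proof -
    have "w = - (v + l + g)" using vlg(1) by (metis minus_minus)
    then show ?thesis unfolding z1_def g12(1) by simp
  qed
  show thesis
  proof
    show "z1 \<in> dual_cone V G"
      using z1_span wG \<open>w \<in> V\<close> g12(2) V by (simp add: dual_cone_def z1_def subspace_add)
    show "v \<in> dual_cone V (poly_cone V B)" by fact
    show L0: "(z1 + v) \<bullet> y = 0" if "y \<in> L" for y
    proof -
      have "y \<bullet> g2 = 0" using g12(3) that L(2) by blast
      then show ?thesis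
        using l[OF that] unfolding sum by (simp add: inner_diff_left inner_commute[of g2])
    qed
    obtain l' where l': "l' \<in> L" "q = a + l'" using q by auto
    have "(z1 + v) \<bullet> q = 0" using z1_span[of q] q wq vlg(3) by (simp add: inner_add_left)
    then show "(z1 + v) \<bullet> a = 0" using L0[OF l'(1)] by (simp add: l'(2) inner_add_right)
    \<comment> \<open>If \<open>z1\<close> vanished on \<open>G\<close>, so would \<open>w\<close>;
      but \<open>w\<close> is a nonzero element of \<open>span G\<close>.\<close>
    show "\<exists>g\<in>G. z1 \<bullet> g \<noteq> 0"
    proof (rule ccontr)
      assume "\<not> ?thesis"
      then have "\<forall>g\<in>G. orthogonal w g" using z1_span by (simp add: orthogonal_def)
      then have "orthogonal w w" using \<open>w \<in> span G\<close> by (meson orthogonal_to_span)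
      then show False using w(2) by (simp add: orthogonal_self)
    qed
  qed
qed

section \<open>Sufficient forms of the Slater condition\<close>

lemma PPS_rel_interior:
  assumes "subspace V" and "C \<subseteq> V" and "convex_cone C" and "closed C"
    and "x \<in> rel_interior C" and "x \<in> (+) b ` M"
  shows "PPS V C M b"
  unfolding PPS_def
  using assms
  by (intro exI[of _ V] exI[of _ "{0}"] exI[of _ C])
    (auto simp: set_plus_def orthogonal_def subspace_single_0 affine_imp_polyhedron)

lemma PPS_polyhedral:
  assumes "subspace V" and "C \<subseteq> V" and "convex_cone C" and "polyhedron C"
    and "x \<in> C" and "x \<in> (+) b ` M"
  shows "PPS V C M b"
  unfolding PPS_def
  using assms
  by (intro exI[of _ V] exI[of _ "{0}"] exI[of _ C])
    (auto simp: set_plus_def orthogonal_def subspace_single_0 polyhedron_imp_closed)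

lemma polyhedron_Times:
  fixes S :: "'a::euclidean_space set" and T :: "'b::euclidean_space set"
  assumes "polyhedron S" and "polyhedron T"
  shows "polyhedron (S \<times> T)"
proof -
  obtain F G where F: "finite F" "S = {x. \<forall>(a, b)\<in>F. a \<bullet> x \<le> b}"
    and G: "finite G" "T = {x. \<forall>(a, b)\<in>G. a \<bullet> x \<le> b}"
    using assms unfolding polyhedron_iff_inequalities by blast
  define H where "H = (\<lambda>(a, b). ((a, 0), b)) ` F \<union> (\<lambda>(a, b). ((0, a), b)) ` G"
  have "S \<times> T = {x :: 'a \<times> 'b. \<forall>(a, b)\<in>H. a \<bullet> x \<le> b}"
    unfolding F G H_def ball_Un ball_simps by (auto simp: case_prod_beta)
  moreover have "finite H" using F(1) G(1) by (simp add: H_def)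
  ultimately show ?thesis unfolding polyhedron_iff_inequalities by blast
qed

text \<open>The orthogonal splitting is the product structure itself, with the semidefinite face as
  the general factor. A diagonal point then has to be relatively interior in its first copy
  only.\<close>

lemma PPS_dnn_face_slater:
  fixes U :: "(real^'n) set"
  assumes "subspace U" and "finite B" and "y \<in> rel_interior (psd_face U)" and "y \<in> poly_cone sym_mats B"
    and "(y, y) \<in> (+) b ` M"
  shows "PPS (sym_mats \<times> sym_mats) (dnn_face U B) M b"
proof -
  have psd: "convex_cone (psd_face U)" "closed (psd_face U)" "psd_face U \<subseteq> sym_mats"
    using convex_cone_psd_face closed_psd_face psd_face_subset_sym assms(1) by auto
  have poly: "convex_cone (poly_cone sym_mats B)" "polyhedron (poly_cone sym_mats B)"
    "poly_cone sym_mats B \<subseteq> sym_mats"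
    using convex_cone_poly_cone polyhedron_poly_cone subspace_sym_mats assms(2)
    by (auto simp: poly_cone_def)
  define V1 :: "((real^'n^'n) \<times> (real^'n^'n)) set" where "V1 = sym_mats \<times> {0}"
  define V2 :: "((real^'n^'n) \<times> (real^'n^'n)) set" where "V2 = {0} \<times> sym_mats"
  define C1 :: "((real^'n^'n) \<times> (real^'n^'n)) set" where "C1 = psd_face U \<times> {0}"
  define C2 :: "((real^'n^'n) \<times> (real^'n^'n)) set" where "C2 = {0} \<times> poly_cone sym_mats B"
  have sums: "S \<times> {0} + {0} \<times> T = S \<times> T" for S T :: "(real^'n^'n) set"
    by (force simp: set_plus_def)
  have "subspace V1" "subspace V2"
    unfolding V1_def V2_def by (simp_all add: subspace_Times subspace_sym_mats)
  moreover have "\<forall>u\<in>V1. \<forall>v\<in>V2. orthogonal u v"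
    by (auto simp: V1_def V2_def orthogonal_def)
  moreover have "sym_mats \<times> sym_mats = V1 + V2" "dnn_face U B = C1 + C2"
    unfolding V1_def V2_def C1_def C2_def sums by simp_all
  moreover have "C1 \<subseteq> V1" "convex_cone C1" "closed C1"
    unfolding C1_def V1_def using psd by (auto intro: convex_cone_Times closed_Times)
  moreover have "C2 \<subseteq> V2" "convex_cone C2"
    unfolding C2_def V2_def using poly by (auto intro: convex_cone_Times)
  moreover have "polyhedron C2"
    unfolding C2_def using poly by (intro polyhedron_Times) (auto intro: affine_imp_polyhedron)
  moreover have "closed C2" using \<open>polyhedron C2\<close> by (rule polyhedron_imp_closed)
  moreover have "\<exists>x1\<in>rel_interior C1. \<exists>x2\<in>C2. x1 + x2 \<in> (+) b ` M"
  proof (intro bexI)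
    have "rel_interior C1 = rel_interior (psd_face U) \<times> {0}"
      unfolding C1_def using psd(1) by (subst rel_interior_Times) (auto simp: convex_cone_def)
    then show "(y, 0) \<in> rel_interior C1" using assms(3) by simp
    show "(0, y) \<in> C2" using assms(4) by (simp add: C2_def)
    show "(y, 0) + (0, y) \<in> (+) b ` M" using assms(5) by simp
  qed
  ultimately show ?thesis
    unfolding PPS_def by (intro exI[of _ V1] exI[of _ V2] exI[of _ C1] exI[of _ C2] conjI)
qed

text \<open>All vectors of a decomposition are multiples of one \<open>u\<close>, so the face is
  generated by \<open>tens u u\<close> alone.\<close>

lemma polyhedron_psd_face:
  fixes U :: "(real^'n) set"
  assumes "subspace U" and "dim U \<le> 1"
  shows "polyhedron (psd_face U)"
proof -
  obtain D where D: "D \<subseteq> U" "independent D" "U \<subseteq> span D" "card D = dim U"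
    using basis_exists by blast
  have "finite D" using D(2) by (rule independent_imp_finite)
  then have "D = {} \<or> (\<exists>u. D = {u})"
    using D(4) assms(2) by (metis One_nat_def card_0_eq card_1_singletonE le_Suc_eq le_zero_eq)
  \<comment> \<open>For the empty basis \<open>u\<close> is 0.\<close>
  then obtain u where u: "u \<in> U" "U \<subseteq> span {u}"
    using D(1,3) subspace_0[OF assms(1)] by (metis insert_subset span_empty span_insert_0)
  have "psd_face U = convex_cone hull {tens u u}"
  proof
    show "convex_cone hull {tens u u} \<subseteq> psd_face U"
      using tens_psd_face[OF assms(1) u(1)] convex_cone_psd_face[OF assms(1)] by (intro hull_minimal) auto
    show "psd_face U \<subseteq> convex_cone hull {tens u u}"
    proof
      fix X assume "X \<in> psd_face U"
      then obtain m v where mv: "X = (\<Sum>i<m::nat. tens (v i) (v i))" "\<And>i. i < m \<Longrightarrow> v i \<in> U"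
        using psd_face_decomposition by blast
      have "tens (v i) (v i) \<in> convex_cone hull {tens u u}" if i: "i < m" for i
      proof -
        obtain c where "v i = c *\<^sub>R u" using u(2) mv(2)[OF i] by (auto simp: span_singleton)
        then have "tens (v i) (v i) = c\<^sup>2 *\<^sub>R tens u u"
          by (simp add: tens_def vec_eq_iff power2_eq_square mult_ac)
        then show ?thesis by (simp add: convex_cone_hull_mul hull_inc)
      qed
      then have "(\<Sum>i<k. tens (v i) (v i)) \<in> convex_cone hull {tens u u}" if "k \<le> m" for k
        using that by (induction k) (auto simp: convex_cone_hull_contains_0 convex_cone_hull_add)
      then show "X \<in> convex_cone hull {tens u u}" by (simp add: mv(1))
    qed
  qed
  then show ?thesis by (simp add: polyhedron_convex_cone_hull)
qed

section \<open>Reduction steps that shrink the subspace\<close>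

text \<open>The definition recurses on the last cut; prepending a direction in the existence proof
  requires peeling off the first.\<close>

lemma reduced_cone_shift:
  "reduced_cone K z (Suc i) = reduced_cone (K \<inter> {z 0}\<^sup>\<bottom>) (z \<circ> Suc) i"
  by (induction i) auto

lemma reducing_directions_Suc:
  "reducing_directions V K M b (Suc k) z \<longleftrightarrow>
    z 0 \<in> dual_cone V K \<inter> orth_compl V M \<inter> orth_compl V {b} \<and>
    reducing_directions V (K \<inter> {z 0}\<^sup>\<bottom>) M b k (z \<circ> Suc)"
  unfolding reducing_directions_def All_less_Suc2 reduced_cone_shift by simp

abbreviation diag :: "'a set \<Rightarrow> ('a \<times> 'a) set" where
  "diag S \<equiv> (\<lambda>x. (x, x)) ` S"

lemma translate_diag: "(+) (a, a) ` diag L = diag ((+) a ` L)"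
  by (simp add: image_image)

text \<open>The pair supplied by \<open>polyhedral_alternative\<close> acts on the diagonal through
  its sum, hence is orthogonal to the diagonal affine space. Its first component is nonzero on the
  face, which makes the new subspace a proper one.\<close>

lemma dnn_reduction_step:
  fixes L :: "(real^'n^'n) set"
  assumes L: "subspace L" "L \<subseteq> sym_mats"
    and U: "subspace U" and B: "finite B" "B \<subseteq> sym_mats"
    and q: "q \<in> (+) a ` L" "(q, q) \<in> dnn_face U B"
    and not_PPS: "\<not> PPS (sym_mats \<times> sym_mats) (dnn_face U B) (diag L) (a, a)"
  obtains z where "z \<in> dual_cone (sym_mats \<times> sym_mats) (dnn_face U B)"
    and "z \<in> orth_compl (sym_mats \<times> sym_mats) (diag L)" and "z \<in> orth_compl (sym_mats \<times> sym_mats) {(a, a)}"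
    and "dim (zero_set U (fst z)) < dim U" and "(q, q) \<in> dnn_face U B \<inter> {z}\<^sup>\<bottom>"
proof -
  have "rel_interior (psd_face U) \<inter> poly_cone sym_mats B \<inter> (+) a ` L = {}"
  proof (rule ccontr)
    assume "\<not> ?thesis"
    then obtain y where y: "y \<in> rel_interior (psd_face U)" "y \<in> poly_cone sym_mats B" "y \<in> (+) a ` L"
      by blast
    then have "(y, y) \<in> (+) (a, a) ` diag L" unfolding translate_diag by blast
    from not_PPS PPS_dnn_face_slater[OF U B(1) y(1,2) this] show False by (rule notE)
  qed
  moreover have "q \<in> psd_face U \<inter> poly_cone sym_mats B \<inter> (+) a ` L" using q by auto
  ultimately obtain z1 z2 where z: "z1 \<in> dual_cone sym_mats (psd_face U)"
      "z2 \<in> dual_cone sym_mats (poly_cone sym_mats B)"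
    and zL: "\<And>y. y \<in> L \<Longrightarrow> (z1 + z2) \<bullet> y = 0" and za: "(z1 + z2) \<bullet> a = 0"
    and proper: "\<exists>X\<in>psd_face U. z1 \<bullet> X \<noteq> 0"
    using polyhedral_alternative[OF subspace_sym_mats B convex_cone_psd_face[OF U] psd_face_subset_sym L]
    by blast
  define z where "z = (z1, z2)"
  have zV: "z \<in> sym_mats \<times> sym_mats" using z by (simp add: z_def dual_cone_def)
  have z_diag: "(y, y) \<bullet> z = (z1 + z2) \<bullet> y" for y
    by (simp add: z_def inner_add_left inner_commute[of y])
  show thesis
  proof
    show dual: "z \<in> dual_cone (sym_mats \<times> sym_mats) (dnn_face U B)"
      using z zV by (auto simp: dual_cone_def z_def)
    show "z \<in> orth_compl (sym_mats \<times> sym_mats) (diag L)"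
      using zV zL by (auto simp: orth_compl_def orthogonal_comp_def orthogonal_def z_diag)
    show "z \<in> orth_compl (sym_mats \<times> sym_mats) {(a, a)}"
      using zV za by (auto simp: orth_compl_def orthogonal_comp_def orthogonal_def z_diag)
    have "zero_set U z1 \<noteq> U"
    proof
      assume "zero_set U z1 = U"
      then have "psd_face U \<subseteq> {X. z1 \<bullet> X = 0}"
        using psd_face_Int_orthogonal[OF U z(1)] by (metis inf_le2)
      then show False using proper by blast
    qed
    then have "zero_set U z1 \<subset> U" by (auto simp: zero_set_def)
    then show "dim (zero_set U (fst z)) < dim U"
      using subspace_zero_set[OF U z(1)] U by (metis dim_psubset fst_conv span_eq_iff z_def)
    obtain l where "l \<in> L" "q = a + l" using q(1) by blast
    then have "(z1 + z2) \<bullet> q = 0" using zL za by (simp add: inner_add_right)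
    then show "(q, q) \<in> dnn_face U B \<inter> {z}\<^sup>\<bottom>"
      using q(2) z_diag[of q] by (auto simp: orthogonal_comp_def orthogonal_def inner_commute)
  qed
qed

text \<open>Induction on a bound for \<open>dim U\<close>, offset by one: at dimension at most 1 the
  cone is polyhedral and the feasible point \<open>q\<close> alone gives the Slater condition. For
  \<open>U = UNIV\<close> this yields the bound \<open>CARD('n) - 1\<close>.\<close>

lemma dnn_reduction_exists:
  fixes L :: "(real^'n^'n) set"
  assumes L: "subspace L" "L \<subseteq> sym_mats" and q: "q \<in> (+) a ` L"
    and U: "subspace U" "dim U \<le> Suc m" and B: "finite B" "B \<subseteq> sym_mats" and "(q, q) \<in> dnn_face U B"
  shows "\<exists>k\<le>m. \<exists>z. reducing_directions (sym_mats \<times> sym_mats) (dnn_face U B) (diag L) (a, a) k z \<and>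
    PPS (sym_mats \<times> sym_mats) (reduced_cone (dnn_face U B) z k) (diag L) (a, a)"
  using U B assms(8)
proof (induction m arbitrary: U B)
  case 0
  have "polyhedron (dnn_face U B)"
    using 0 by (intro polyhedron_Times polyhedron_psd_face polyhedron_poly_cone subspace_sym_mats) auto
  moreover have "(q, q) \<in> (+) (a, a) ` diag L" unfolding translate_diag using q by blast
  moreover have "dnn_face U B \<subseteq> sym_mats \<times> sym_mats"
    using psd_face_subset_sym by (auto simp: poly_cone_def)
  ultimately have "PPS (sym_mats \<times> sym_mats) (dnn_face U B) (diag L) (a, a)"
    using 0 by (intro PPS_polyhedral[of _ _ "(q, q)"] convex_cone_dnn_face)
      (simp_all add: subspace_Times subspace_sym_mats)
  then show ?case by (simp add: reducing_directions_def)
next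
  case (Suc m)
  show ?case
  proof (cases "PPS (sym_mats \<times> sym_mats) (dnn_face U B) (diag L) (a, a)")
    case True
    then show ?thesis by (intro exI[of _ 0]) (simp add: reducing_directions_def)
  next
    case False
    obtain z0 where z0: "z0 \<in> dual_cone (sym_mats \<times> sym_mats) (dnn_face U B)"
        "z0 \<in> orth_compl (sym_mats \<times> sym_mats) (diag L)" "z0 \<in> orth_compl (sym_mats \<times> sym_mats) {(a, a)}"
      and dim: "dim (zero_set U (fst z0)) < dim U" and q0: "(q, q) \<in> dnn_face U B \<inter> {z0}\<^sup>\<bottom>"
      using dnn_reduction_step[OF L Suc.prems(1,3,4) q Suc.prems(5) False] by blast
    note step = dnn_face_step[OF Suc.prems(1) z0(1)]
    have "- snd z0 \<in> sym_mats" using step(3) subspace_neg[OF subspace_sym_mats] by blast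
    then have "\<exists>k\<le>m. \<exists>z. reducing_directions (sym_mats \<times> sym_mats) (dnn_face U B \<inter> {z0}\<^sup>\<bottom>) (diag L) (a, a) k z \<and>
        PPS (sym_mats \<times> sym_mats) (reduced_cone (dnn_face U B \<inter> {z0}\<^sup>\<bottom>) z k) (diag L) (a, a)"
      unfolding step(1) using Suc.prems dim step(2) q0[unfolded step(1)] by (intro Suc.IH) auto
    then obtain k z where k: "k \<le> m"
      and z: "reducing_directions (sym_mats \<times> sym_mats) (dnn_face U B \<inter> {z0}\<^sup>\<bottom>) (diag L) (a, a) k z"
        "PPS (sym_mats \<times> sym_mats) (reduced_cone (dnn_face U B \<inter> {z0}\<^sup>\<bottom>) z k) (diag L) (a, a)"
      by blast
    define z' where "z' = case_nat z0 z"
    have z': "z' 0 = z0" "z' \<circ> Suc = z" by (auto simp: z'_def)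
    have "reducing_directions (sym_mats \<times> sym_mats) (dnn_face U B) (diag L) (a, a) (Suc k) z'"
      unfolding reducing_directions_Suc z' using z0 z(1) by blast
    moreover have "PPS (sym_mats \<times> sym_mats) (reduced_cone (dnn_face U B) z' (Suc k)) (diag L) (a, a)"
      unfolding reduced_cone_shift z' by (rule z(2))
    ultimately show ?thesis using k by (intro exI[of _ "Suc k"]) auto
  qed
qed

section \<open>Comparison with the singularity degree and the dimension\<close>

lemma reduced_cone_subset: "reduced_cone K z i \<subseteq> K"
  by (induction i) auto

lemma closed_reduced_cone: "closed K \<Longrightarrow> closed (reduced_cone K z i)"
  by (induction i) (auto simp: closed_Int closed_subspace subspace_orthogonal_comp)

lemma reduced_cone_orthogonal:
  "j < i \<Longrightarrow> x \<in> reduced_cone K z i \<Longrightarrow> z j \<bullet> x = 0"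
  by (induction i) (auto simp: less_Suc_eq orthogonal_comp_def orthogonal_def)

lemma reduced_cone_cong:
  "(\<And>j. j < i \<Longrightarrow> z j = z' j) \<Longrightarrow> reduced_cone K z i = reduced_cone K z' i"
  by (induction i) auto

text \<open>Reducing directions vanish on the affine space, so the cuts lose no feasible
  point.\<close>

lemma feasible_in_reduced_cone:
  assumes "reducing_directions V K M b k z" and "x \<in> K" and "x \<in> (+) b ` M"
  shows "x \<in> reduced_cone K z k"
  using assms
proof (induction k)
  case (Suc k)
  then have "z k \<in> orth_compl V M" "z k \<in> orth_compl V {b}" "x \<in> reduced_cone K z k"
    by (auto simp: reducing_directions_def)
  then show ?case
    using Suc.prems(3)
    by (auto simp: orth_compl_def orthogonal_comp_def orthogonal_def inner_add_left inner_commute[of "z k"])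
qed simp

section \<open>Minimal faces and the singularity degree\<close>

lemma convex_cone_minimal_face:
  assumes "convex_cone K"
  shows "convex_cone (minimal_face K S)"
  unfolding minimal_face_def by (rule convex_cone_Inter) (simp add: cone_face_def)

text \<open>The minimal face is contained in the face generated by \<open>s\<close>, so a small
  multiple of each of its points can be subtracted from \<open>s\<close> within \<open>K\<close>.
  Hence every segment from such a point to \<open>s\<close> can be prolonged beyond
  \<open>s\<close>.\<close>

lemma rel_interior_minimal_face:
  fixes K :: "'a::euclidean_space set"
  assumes K: "convex_cone K" and S: "convex S" "S \<subseteq> K" "s \<in> rel_interior S"
  shows "s \<in> rel_interior (minimal_face K S)"
proof -
  have "s \<in> S" using S(3) rel_interior_subset by blast
  \<comment> \<open>The face generated by \<open>s\<close>: the elements of \<open>K\<close> of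
    which some positive multiple is a summand of \<open>s\<close> in \<open>K\<close>.\<close>
  define F where "F = {y \<in> K. \<exists>t>0. s - t *\<^sub>R y \<in> K}"
  have smaller: "s - r *\<^sub>R y \<in> K" if "y \<in> K" "s - t *\<^sub>R y \<in> K" "0 \<le> r" "r \<le> t" for y t r
  proof -
    have "s - r *\<^sub>R y = (s - t *\<^sub>R y) + (t - r) *\<^sub>R y" by (simp add: algebra_simps)
    moreover have "\<dots> \<in> K"
      using that by (intro convex_cone_add[OF K] convex_cone_scaleR[OF K]) auto
    ultimately show ?thesis by metis
  qed
  have "cone_face F K"
    unfolding cone_face_def convex_cone_iff
  proof (intro conjI ballI allI impI)
    show "0 \<in> F" using convex_cone_contains_0[OF K] \<open>s \<in> S\<close> S(2) by (auto simp: F_def intro: exI[of _ 1])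
    show "F \<subseteq> K" by (auto simp: F_def)
  next
    fix x y assume "x \<in> F" "y \<in> F"
    then obtain t r where tr: "t > 0" "r > 0" "s - t *\<^sub>R x \<in> K" "s - r *\<^sub>R y \<in> K" and xy: "x \<in> K" "y \<in> K"
      by (auto simp: F_def)
    define p where "p = min t r"
    have "s - p *\<^sub>R x \<in> K" "s - p *\<^sub>R y \<in> K"
      using smaller[OF xy(1) tr(3)] smaller[OF xy(2) tr(4)] tr(1,2) by (auto simp: p_def)
    then have "(1/2) *\<^sub>R (s - p *\<^sub>R x) + (1/2) *\<^sub>R (s - p *\<^sub>R y) \<in> K"
      by (intro convex_cone_add[OF K] convex_cone_scaleR[OF K]) auto
    moreover have "(1/2) *\<^sub>R (s - p *\<^sub>R x) + (1/2) *\<^sub>R (s - p *\<^sub>R y) = s - (p / 2) *\<^sub>R (x + y)"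
      by (simp add: algebra_simps flip: scaleR_add_left)
    ultimately show "x + y \<in> F"
      using xy tr convex_cone_add[OF K] unfolding F_def
      by (intro CollectI conjI exI[of _ "p / 2"]) (auto simp: p_def)
  next
    fix x and c :: real assume x: "x \<in> F" and "0 \<le> c"
    then obtain t where t: "t > 0" "s - t *\<^sub>R x \<in> K" "x \<in> K" by (auto simp: F_def)
    \<comment> \<open>The denominator \<open>c + 1\<close> also covers \<open>c = 0\<close> and
      keeps the total multiple of \<open>x\<close> at most \<open>t\<close>.\<close>
    have "s - (t / (c + 1)) *\<^sub>R c *\<^sub>R x \<in> K"
      unfolding scaleR_scaleR using t \<open>0 \<le> c\<close> by (intro smaller[OF t(3,2)]) (auto simp: field_simps)
    then show "c *\<^sub>R x \<in> F"
      using t \<open>0 \<le> c\<close> convex_cone_scaleR[OF K] by (auto simp: F_def intro!: exI[of _ "t / (c + 1)"])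
  next
    fix x y assume xy: "x \<in> K" "y \<in> K" "x + y \<in> F"
    then obtain t where t: "t > 0" "s - t *\<^sub>R (x + y) \<in> K" by (auto simp: F_def)
    have "(s - t *\<^sub>R (x + y)) + t *\<^sub>R y \<in> K" "(s - t *\<^sub>R (x + y)) + t *\<^sub>R x \<in> K"
      using t xy by (auto intro!: convex_cone_add[OF K] convex_cone_scaleR[OF K])
    then have "s - t *\<^sub>R x \<in> K" "s - t *\<^sub>R y \<in> K"
      by (simp_all add: algebra_simps)
    then show "x \<in> F" "y \<in> F" using t xy by (auto simp: F_def)
  qed
  moreover have "S \<subseteq> F"
  proof
    fix y assume "y \<in> S"
    \<comment> \<open>Prolonging the segment from \<open>y\<close> beyond \<open>s\<close> inside
      \<open>S\<close> and rescaling by \<open>1 / e\<close> exhibits \<open>s\<close> minus a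
      positive multiple of \<open>y\<close> as an element of \<open>K\<close>.\<close>
    then obtain e where e: "e > 1" "(1 - e) *\<^sub>R y + e *\<^sub>R s \<in> S"
      using convex_rel_interior_iff[OF S(1), of s] S(3) by blast
    then have "(1 / e) *\<^sub>R ((1 - e) *\<^sub>R y + e *\<^sub>R s) \<in> K"
      using S(2) by (intro convex_cone_scaleR[OF K]) auto
    moreover have "(1 / e) *\<^sub>R ((1 - e) *\<^sub>R y + e *\<^sub>R s) = s - ((e - 1) / e) *\<^sub>R y"
      using e(1) by (simp add: algebra_simps diff_divide_distrib)
    ultimately show "y \<in> F"
      using \<open>y \<in> S\<close> S(2) e(1) by (auto simp: F_def intro!: exI[of _ "(e - 1) / e"])
  qed
  ultimately have min: "minimal_face K S \<subseteq> F" by (auto simp: minimal_face_def)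
  have "cone_face K K" using K by (simp add: cone_face_def)
  then have minK: "minimal_face K S \<subseteq> K" using S(2) by (auto simp: minimal_face_def)
  have s: "s \<in> minimal_face K S" using \<open>s \<in> S\<close> by (auto simp: minimal_face_def)
  have conv: "convex_cone (minimal_face K S)" by (rule convex_cone_minimal_face[OF K])
  have split: "x \<in> minimal_face K S" if "x \<in> K" "y \<in> K" "x + y \<in> minimal_face K S" for x y
    using that unfolding minimal_face_def cone_face_def by blast
  show ?thesis
  proof (subst convex_rel_interior_iff)
    show "convex (minimal_face K S)" "minimal_face K S \<noteq> {}" using conv by (auto simp: convex_cone_def)
    show "\<forall>y\<in>minimal_face K S. \<exists>e>1. (1 - e) *\<^sub>R y + e *\<^sub>R s \<in> minimal_face K S"
    proof
      fix y assume y: "y \<in> minimal_face K S"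
      then obtain t where t: "t > 0" "s - t *\<^sub>R y \<in> K" using min by (auto simp: F_def)
      \<comment> \<open>Adding back the multiple of \<open>y\<close> gives \<open>s\<close>, so the
        face property puts this summand into the minimal face.\<close>
      have "s - t *\<^sub>R y \<in> minimal_face K S"
        using split[of "s - t *\<^sub>R y" "t *\<^sub>R y"] t s y minK convex_cone_scaleR[OF K] by auto
      then have "s + (s - t *\<^sub>R y) \<in> minimal_face K S" by (rule convex_cone_add[OF conv s])
      \<comment> \<open>The prolonged point is a nonnegative combination of points of the minimal
        face, which is a convex cone.\<close>
      moreover have "(1 - (1 + t / 2)) *\<^sub>R y + (1 + t / 2) *\<^sub>R s = (t / 2) *\<^sub>R s + (1 / 2) *\<^sub>R (s + (s - t *\<^sub>R y))"
      proof -
        have "s + (s - t *\<^sub>R y) = 2 *\<^sub>R s - t *\<^sub>R y" by (simp add: scaleR_2)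
        then show ?thesis by (simp add: algebra_simps)
      qed
      ultimately have "(1 - (1 + t / 2)) *\<^sub>R y + (1 + t / 2) *\<^sub>R s \<in> minimal_face K S"
        using t(1) s by (simp add: convex_cone_add[OF conv] convex_cone_scaleR[OF conv])
      then show "\<exists>e>1. (1 - e) *\<^sub>R y + e *\<^sub>R s \<in> minimal_face K S"
        using t(1) by (intro exI[of _ "1 + t / 2"]) auto
    qed
  qed
qed

lemma d_PPS_le_d_S:
  assumes V: "subspace V" and K: "convex_cone K" "closed K" "K \<subseteq> V" and M: "subspace M"
    and feasible: "K \<inter> (+) b ` M \<noteq> {}"
  shows "d_PPS V K M b \<le> d_S V K M b"
  unfolding d_PPS_def d_S_def
proof (rule Inf_superset_mono, safe)
  fix k z
  assume z: "reducing_directions V K M b k z" and min: "reduced_cone K z k = minimal_face K (K \<inter> (+) b ` M)"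
  have "affine ((+) b ` M)" using M by (metis affine_translation subspace_imp_affine)
  then have conv: "convex (K \<inter> (+) b ` M)"
    using K(1) affine_imp_convex convex_Int unfolding convex_cone_def by blast
  then obtain s where s: "s \<in> rel_interior (K \<inter> (+) b ` M)"
    using rel_interior_eq_empty feasible by blast
  then have "s \<in> rel_interior (reduced_cone K z k)"
    unfolding min using rel_interior_minimal_face[OF K(1) conv] by blast
  moreover have "s \<in> (+) b ` M" using s rel_interior_subset by blast
  moreover have "convex_cone (reduced_cone K z k)" unfolding min by (rule convex_cone_minimal_face[OF K(1)])
  ultimately have "PPS V (reduced_cone K z k) M b"
    using V K reduced_cone_subset by (intro PPS_rel_interior closed_reduced_cone) blast+
  with z show "\<exists>k'. enat k = enat k' \<and> (\<exists>z. reducing_directions V K M b k' z \<and> PPS V (reduced_cone K z k') M b)"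
    by blast
qed

lemma d_PPS_attained:
  assumes "reducing_directions V K M b k z" and "PPS V (reduced_cone K z k) M b"
  obtains k' z' where "d_PPS V K M b = enat k'" and "k' \<le> k"
    and "reducing_directions V K M b k' z'" and "PPS V (reduced_cone K z' k') M b"
proof -
  define I where "I = {enat k |k. \<exists>z. reducing_directions V K M b k z \<and> PPS V (reduced_cone K z k) M b}"
  have "enat k \<in> I" using assms by (auto simp: I_def)
  then have "d_PPS V K M b \<in> I" "d_PPS V K M b \<le> enat k"
    unfolding d_PPS_def I_def[symmetric] by (auto simp: Inf_enat_def intro: LeastI Least_le)
  then show thesis using that by (auto simp: I_def)
qed

text \<open>
  In a shortest sequence every direction is linearly independent of the previous ones, since a
  dependent direction would not change the cone and could be dropped.
\<close>

lemma d_PPS_le_dim: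
  assumes d: "d_PPS V K M b = enat k" and z: "reducing_directions V K M b k z"
    and pps: "PPS V (reduced_cone K z k) M b"
  shows "k \<le> dim (orth_compl V M \<inter> orth_compl V {b})"
proof -
  have new: "z i \<notin> span (z ` {..<i})" if "i < k" for i
  proof
    assume dep: "z i \<in> span (z ` {..<i})"
    have "reduced_cone K z i \<subseteq> {z i}\<^sup>\<bottom>"
    proof
      fix x assume x: "x \<in> reduced_cone K z i"
      \<comment> \<open>Points of the reduced cone are orthogonal to all earlier directions, hence
        to anything in their span.\<close>
      have "orthogonal x (z i)"
        using dep by (rule orthogonal_to_span) (use reduced_cone_orthogonal[OF _ x] in \<open>auto simp: orthogonal_def inner_commute\<close>)
      then show "x \<in> {z i}\<^sup>\<bottom>" by (simp add: orthogonal_comp_def orthogonal_commute)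
    qed
    then have same: "reduced_cone K z (Suc i) = reduced_cone K z i" by auto
    \<comment> \<open>Omits the direction at position \<open>i\<close>; from there on the cones are
      the old ones shifted by one, so later directions remain admissible.\<close>
    define z' where "z' j = (if j < i then z j else z (Suc j))" for j
    have before: "reduced_cone K z' j = reduced_cone K z j" if "j \<le> i" for j
      using that by (intro reduced_cone_cong) (auto simp: z'_def)
    have after: "reduced_cone K z' j = reduced_cone K z (Suc j)" if "i \<le> j" for j
      using that
    proof (induction j rule: dec_induct)
      case base
      then show ?case using before[of i] same by simp
    next
      case (step j)
      then show ?case by (simp add: z'_def)
    qed
    have "reducing_directions V K M b (k - 1) z'"
      unfolding reducing_directions_def
    proof (intro allI impI)
      fix j assume j: "j < k - 1"
      show "z' j \<in> dual_cone V (reduced_cone K z' j) \<inter> orth_compl V M \<inter> orth_compl V {b}"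
      proof (cases "j < i")
        case True
        then show ?thesis using z \<open>i < k\<close> before[of j] by (simp add: z'_def reducing_directions_def)
      next
        case False
        then have "z' j = z (Suc j)" "reduced_cone K z' j = reduced_cone K z (Suc j)"
          using after[of j] by (auto simp: z'_def)
        moreover have "Suc j < k" using j by simp
        ultimately show ?thesis using z unfolding reducing_directions_def by metis
      qed
    qed
    moreover have "reduced_cone K z' (k - 1) = reduced_cone K z k"
      using after[of "k - 1"] that by simp
    ultimately have "enat k \<le> enat (k - 1)"
      using pps unfolding d[symmetric] d_PPS_def by (intro Inf_lower) auto
    then show False using that by simp
  qed
  have "independent (z ` {..<i}) \<and> card (z ` {..<i}) = i" if "i \<le> k" for i
    using that
  proof (induction i)
    case (Suc i)
    then have "z i \<notin> span (z ` {..<i})" using new by simp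
    moreover from this have "z i \<notin> z ` {..<i}" using span_superset[of "z ` {..<i}"] by blast
    ultimately show ?case
      using Suc by (simp add: lessThan_Suc independent_insert)
  qed (simp add: independent_empty)
  from this[of k] have "independent (z ` {..<k})" "card (z ` {..<k}) = k" by auto
  moreover have "z ` {..<k} \<subseteq> orth_compl V M \<inter> orth_compl V {b}"
    using z by (auto simp: reducing_directions_def)
  ultimately show ?thesis by (metis independent_card_le_dim)
qed

section \<open>The doubly nonnegative cone\<close>

text \<open>The coordinate functionals are symmetrised because the Farkas argument needs normals
  inside \<open>sym_mats\<close>; on symmetric matrices this just doubles the entry.\<close>

lemma nonneg_cone_eq_poly_cone:
  obtains B :: "(real^'n^'n) set" where "finite B" and "B \<subseteq> sym_mats" and "nonneg_cone = poly_cone sym_mats B"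
proof -
  define E :: "'n \<times> 'n \<Rightarrow> real^'n^'n"
    where "E = (\<lambda>(i, j). tens (axis i 1) (axis j 1) + tens (axis j 1) (axis i 1))"
  have "E p \<bullet> X = 2 * X $ fst p $ snd p" if "X \<in> sym_mats" for p X
  proof -
    have "X $ j $ i = X $ i $ j" for i j
      using that by (auto simp: sym_mats_def transpose_def vec_eq_iff)
    then show ?thesis
      by (simp add: E_def case_prod_beta inner_add_left inner_tens inner_axis' matrix_vector_mult_basis column_def)
  qed
  then have "nonneg_cone = poly_cone sym_mats (range E)"
    by (auto simp: nonneg_cone_def poly_cone_def)
  moreover have "range E \<subseteq> sym_mats"
    by (auto simp: E_def sym_mats_def tens_def transpose_def vec_eq_iff)
  moreover have "finite (range E)" by simp
  ultimately show thesis using that by blast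
qed

section \<open>Passing to the diagonal\<close>

text \<open>A translate determines its direction space, but its base point only up to that space.
  This is all the freedom in choosing \<open>Lh\<close> and \<open>ah\<close>.\<close>

lemma diag_translate_eqD:
  fixes Lh :: "('a::real_vector \<times> 'a) set"
  assumes "subspace Lh" and "subspace L" and eq: "(+) ah ` Lh = {(x, x) |x. x \<in> (+) a ` L}"
  obtains a' where "ah = (a', a')" and "Lh = diag L" and "(+) a' ` L = (+) a ` L"
proof -
  have "ah \<in> {(x, x) |x. x \<in> (+) a ` L}"
    unfolding eq[symmetric] using subspace_0[OF assms(1)] by force
  then obtain l where l: "l \<in> L" "ah = (a + l, a + l)" by auto
  have trans: "(+) (a + l) ` L = (+) a ` L"
  proof (intro set_eqI iffI)
    fix x assume "x \<in> (+) (a + l) ` L"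
    then obtain y where "y \<in> L" "x = a + (l + y)" by (auto simp: add.assoc)
    then show "x \<in> (+) a ` L" using subspace_add[OF assms(2) l(1)] by blast
  next
    fix x assume "x \<in> (+) a ` L"
    then obtain y where "y \<in> L" "x = (a + l) + (y - l)" by auto
    then show "x \<in> (+) (a + l) ` L" using subspace_diff[OF assms(2) _ l(1)] by blast
  qed
  have "(+) ah ` Lh = diag ((+) a ` L)" unfolding eq by auto
  also have "\<dots> = (+) ah ` diag L" unfolding l(2) translate_diag trans ..
  finally have "Lh = diag L" by (simp add: inj_image_eq_iff)
  then show thesis using that l(2) trans by blast
qed

lemma orth_compl_translate:
  assumes "subspace M"
  shows "orth_compl V M \<inter> orth_compl V {b} = orth_compl V ((+) b ` M)"
proof (intro set_eqI iffI)
  fix z assume "z \<in> orth_compl V M \<inter> orth_compl V {b}"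
  then show "z \<in> orth_compl V ((+) b ` M)"
    by (auto simp: orth_compl_def orthogonal_comp_def orthogonal_def inner_add_left)
next
  fix z assume z: "z \<in> orth_compl V ((+) b ` M)"
  then have sum: "(b + y) \<bullet> z = 0" if "y \<in> M" for y
    using that by (auto simp: orth_compl_def orthogonal_comp_def orthogonal_def)
  have "b \<bullet> z = 0" using sum[OF subspace_0[OF assms]] by simp
  moreover have "y \<bullet> z = 0" if "y \<in> M" for y
    using sum[OF that] \<open>b \<bullet> z = 0\<close> by (simp add: inner_add_left)
  ultimately show "z \<in> orth_compl V M \<inter> orth_compl V {b}"
    using z by (auto simp: orth_compl_def orthogonal_comp_def orthogonal_def)
qed

text \<open>The joint orthogonality to \<open>M\<close> and \<open>b\<close> is orthogonality to the
  translate, and \<open>PPS\<close> mentions \<open>b\<close> only through the translate.\<close>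

lemma d_PPS_cong:
  assumes "subspace M" and "(+) b ` M = (+) b' ` M"
  shows "d_PPS V K M b = d_PPS V K M b'"
proof -
  have "orth_compl V M \<inter> orth_compl V {b} = orth_compl V M \<inter> orth_compl V {b'}"
    by (simp add: orth_compl_translate[OF assms(1)] assms(2))
  then have "reducing_directions V K M b k z \<longleftrightarrow> reducing_directions V K M b' k z" for k z
    unfolding reducing_directions_def by (simp add: Int_assoc)
  then show ?thesis unfolding d_PPS_def PPS_def assms(2) by simp
qed

lemma dist_diag: "dist (x, x) (y, y) = sqrt 2 * dist x y"
  by (simp add: dist_Pair_Pair real_sqrt_mult)

lemma infdist_diag_le:
  fixes S :: "'a::metric_space set"
  assumes "S \<noteq> {}"
  shows "infdist x S \<le> infdist (x, x) (diag S)"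
proof -
  have "infdist x S \<le> dist (x, x) (y, y)" if "y \<in> S" for y
    using infdist_le[OF that, of x] dist_fst_le[of "(x, x)" "(y, y)"] by simp
  then show ?thesis
    using assms by (subst infdist_notempty[of "diag S"]) (auto intro!: cINF_greatest)
qed

text \<open>The diagonal embedding stretches distances by \<open>sqrt 2\<close>, rounded up to 2.
  The larger set \<open>T\<close> allows the product cone to stand in for the diagonal copy of
  \<open>dnn_cone\<close>.\<close>

lemma infdist_diag_diag:
  fixes S :: "'a::euclidean_space set"
  assumes "closed S" and "S \<noteq> {}" and "diag S \<subseteq> T" and "infdist x S \<le> e"
  shows "infdist (x, x) T \<le> 2 * e"
proof -
  obtain y where y: "y \<in> S" "infdist x S = dist x y"
    using infdist_attains_inf[OF assms(1,2), of x] by blast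
  have "dist (x, x) (y, y) \<le> 2 * dist x y"
    unfolding dist_diag by (intro mult_right_mono) (auto simp: real_le_lsqrt)
  then show ?thesis using assms(3,4) y by (intro infdist_le2[of "(y, y)"]) auto
qed

text \<open>Two estimates are chained at \<open>(x, x)\<close>: reduction bounds the distance to the
  last cone by a Hoelder sum, and this sum is the error fed into the Slater estimate, whose factor
  is linear in the norm.\<close>

lemma dnn_error_bound:
  fixes L :: "(real^'n^'n) set"
  assumes L: "subspace L" and feasible: "dnn_cone \<inter> (+) a ` L \<noteq> {}"
    and z: "reducing_directions (sym_mats \<times> sym_mats) (psd_cone \<times> nonneg_cone) (diag L) (a, a) k z"
    and pps: "PPS (sym_mats \<times> sym_mats) (reduced_cone (psd_cone \<times> nonneg_cone) z k) (diag L) (a, a)"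
  obtains \<kappa> where "\<kappa> > 0"
    and "\<And>x e. \<lbrakk>infdist x dnn_cone \<le> e; infdist x ((+) a ` L) \<le> e\<rbrakk>
      \<Longrightarrow> infdist x ((+) a ` L \<inter> dnn_cone) \<le> (\<kappa> * norm x + \<kappa>) * holder_sum e (norm x) k"
proof -
  define K :: "((real^'n^'n) \<times> (real^'n^'n)) set" where "K = psd_cone \<times> nonneg_cone"
  define A where "A = (+) a ` L"
  define F where "F = reduced_cone K z k"
  obtain B :: "(real^'n^'n) set" where B: "finite B" "B \<subseteq> sym_mats" "nonneg_cone = poly_cone sym_mats B"
    by (rule nonneg_cone_eq_poly_cone)
  have K: "K = dnn_face UNIV B" by (simp add: K_def psd_face_UNIV B(3))
  have diagL: "subspace (diag L)"
    using L by (intro linear_subspace_image) (auto intro!: linearI)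
  have A_diag: "(+) (a, a) ` diag L = diag A" unfolding A_def by (rule translate_diag)
  have closed: "closed A" "closed (dnn_cone :: (real^'n^'n) set)"
  proof -
    show "closed A" unfolding A_def using closed_subspace[OF L] by (rule closed_translation)
    have "closed (psd_cone :: (real^'n^'n) set)"
      using closed_psd_face[OF subspace_UNIV] by (simp add: psd_face_UNIV)
    then show "closed (dnn_cone :: (real^'n^'n) set)"
      unfolding dnn_cone_def B(3)
      using polyhedron_imp_closed[OF polyhedron_poly_cone[OF subspace_sym_mats B(1)]] by (rule closed_Int)
  qed
  \<comment> \<open>A diagonal point lies in the product cone exactly if its entry is doubly
    nonnegative, and no feasible point is cut off.\<close>
  have FA: "F \<inter> diag A = diag (A \<inter> dnn_cone)"
  proof
    show "F \<inter> diag A \<subseteq> diag (A \<inter> dnn_cone)"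
      using reduced_cone_subset[of K z k] by (auto simp: F_def K_def dnn_cone_def)
    show "diag (A \<inter> dnn_cone) \<subseteq> F \<inter> diag A"
      using feasible_in_reduced_cone[OF z] unfolding A_diag F_def K_def by (auto simp: dnn_cone_def)
  qed
  obtain U' B' h where U': "subspace U'" "finite B'" "F = dnn_face U' B'" and h: "h > 0"
    "\<And>x e r. \<lbrakk>infdist x K \<le> e; infdist x (diag A) \<le> e; norm x \<le> r\<rbrakk> \<Longrightarrow> infdist x F \<le> h * holder_sum e r k"
    using reduced_dnn_face[OF subspace_UNIV B(1) diagL, of "(a, a)" k z] z
    unfolding A_diag F_def K[symmetric] K_def[symmetric] by blast
  have "closed F" unfolding U'(3) by (rule closed_dnn_face[OF U'(1,2)])
  then obtain g where g: "g > 0"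
    "\<And>x e. \<lbrakk>infdist x F \<le> e; infdist x (diag A) \<le> e\<rbrakk> \<Longrightarrow> infdist x (F \<inter> diag A) \<le> (g * norm x + g) * e"
    using PPS_error_bound[OF pps diagL] unfolding A_diag F_def K_def by blast
  \<comment> \<open>Covers both \<open>2 * h\<close>, from the reduction, and the factor 2 in the
    distance to the diagonal affine space.\<close>
  define c where "c = 2 * (h + 1)"
  show thesis
  proof
    show "2 * g * c > 0" using g(1) h(1) by (simp add: c_def)
    fix x e assume x: "infdist x dnn_cone \<le> e" "infdist x ((+) a ` L) \<le> e"
    have "0 \<le> e" using x(1) infdist_nonneg order_trans by blast
    define T where "T = holder_sum e (norm x) k"
    have "e \<le> T" unfolding T_def by (rule le_holder_sum)
    have xK: "infdist (x, x) K \<le> 2 * e"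
      using feasible by (intro infdist_diag_diag[OF closed(2) _ _ x(1)]) (auto simp: K_def dnn_cone_def)
    have xA: "infdist (x, x) (diag A) \<le> 2 * e"
      using feasible by (intro infdist_diag_diag[OF closed(1) _ _ x(2)[folded A_def]]) (auto simp: A_def)
    have norm_x: "norm (x, x) \<le> 2 * norm x"
      using norm_Pair_le[of x x] by simp
    have "infdist (x, x) F \<le> h * holder_sum (2 * e) (2 * norm x) k"
      by (rule h(2)[OF xK xA norm_x])
    also have "\<dots> = 2 * h * T"
      using \<open>0 \<le> e\<close> by (simp add: holder_sum_scale T_def)
    also have "\<dots> \<le> c * T" using \<open>0 \<le> e\<close> \<open>e \<le> T\<close> by (intro mult_right_mono) (auto simp: c_def)
    finally have xF: "infdist (x, x) F \<le> c * T" .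
    have "2 * e \<le> c * T" using \<open>0 \<le> e\<close> \<open>e \<le> T\<close> h(1) by (intro mult_mono) (auto simp: c_def)
    then have xA': "infdist (x, x) (diag A) \<le> c * T" using xA by simp
    have "A \<inter> dnn_cone \<noteq> {}" using feasible by (auto simp: A_def)
    then have "infdist x (A \<inter> dnn_cone) \<le> infdist (x, x) (F \<inter> diag A)"
      unfolding FA by (rule infdist_diag_le)
    also have "\<dots> \<le> (g * norm (x, x) + g) * (c * T)" by (rule g(2)[OF xF xA'])
    also have "\<dots> \<le> (2 * g * norm x + 2 * g) * (c * T)"
    proof (rule mult_right_mono)
      show "0 \<le> c * T" using \<open>0 \<le> e\<close> \<open>e \<le> T\<close> h(1) by (simp add: c_def)
      have "g * norm (x, x) \<le> g * (2 * norm x)"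
        using norm_x g(1) by (intro mult_left_mono) auto
      then have "g * norm (x, x) + g \<le> g * (2 * norm x) + 2 * g" using g(1) by linarith
      also have "\<dots> = 2 * g * norm x + 2 * g" by simp
      finally show "g * norm (x, x) + g \<le> 2 * g * norm x + 2 * g" .
    qed
    also have "\<dots> = (2 * g * c * norm x + 2 * g * c) * T" by (simp add: algebra_simps)
    finally show "infdist x ((+) a ` L \<inter> dnn_cone) \<le> (2 * g * c * norm x + 2 * g * c) * holder_sum e (norm x) k"
      by (simp add: A_def T_def)
  qed
qed

theorem proposition41:
  fixes L :: "(real^'n^'n) set" and a :: "real^'n^'n"
  assumes "subspace L" and "L \<subseteq> sym_mats" and "a \<in> sym_mats"
    and "dnn_cone \<inter> (+) a ` L \<noteq> {}"
  shows "\<exists>\<kappa>>0. \<forall>Lh ah.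
    subspace Lh \<and> Lh \<subseteq> sym_mats \<times> sym_mats \<and> ah \<in> sym_mats \<times> sym_mats \<and>
    (+) ah ` Lh = {(x, x) |x. x \<in> (+) a ` L}
    \<longrightarrow>
    (\<forall>x\<in>sym_mats. \<forall>\<epsilon>::real.
       infdist x dnn_cone \<le> \<epsilon> \<and> infdist x ((+) a ` L) \<le> \<epsilon> \<longrightarrow>
       infdist x ((+) a ` L \<inter> dnn_cone)
         \<le> (\<kappa> * norm x + \<kappa>) *
           (\<epsilon> + (\<Sum>j = 1..the_enat (d_PPS (sym_mats \<times> sym_mats) (psd_cone \<times> nonneg_cone) Lh ah).
                   \<epsilon> powr (1 / 2 ^ j) * norm x powr (1 - 1 / 2 ^ j)))) \<and>
    d_PPS (sym_mats \<times> sym_mats) (psd_cone \<times> nonneg_cone) Lh ah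
      \<le> Min {enat (CARD('n) - 1),
             enat (dim (orth_compl (sym_mats \<times> sym_mats) Lh
                        \<inter> orth_compl (sym_mats \<times> sym_mats) {ah})),
             d_S (sym_mats \<times> sym_mats) (psd_cone \<times> nonneg_cone) Lh ah}"
proof -
  define V :: "((real^'n^'n) \<times> (real^'n^'n)) set" where "V = sym_mats \<times> sym_mats"
  define K :: "((real^'n^'n) \<times> (real^'n^'n)) set" where "K = psd_cone \<times> nonneg_cone"
  obtain q where q: "q \<in> dnn_cone" "q \<in> (+) a ` L" using assms(4) by blast
  obtain B :: "(real^'n^'n) set" where B: "finite B" "B \<subseteq> sym_mats" "nonneg_cone = poly_cone sym_mats B"
    by (rule nonneg_cone_eq_poly_cone)
  have K: "K = dnn_face UNIV B" by (simp add: K_def psd_face_UNIV B(3))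
  have diagL: "subspace (diag L)"
    using assms(1) by (intro linear_subspace_image) (auto intro!: linearI)
  have short: "\<exists>k\<le>CARD('n) - 1. \<exists>z. reducing_directions V K (diag L) (a', a') k z \<and>
      PPS V (reduced_cone K z k) (diag L) (a', a')" if "(+) a' ` L = (+) a ` L" for a'
    unfolding V_def K
  proof (rule dnn_reduction_exists[OF assms(1,2) _ subspace_UNIV _ B(1,2)])
    show "q \<in> (+) a' ` L" using q(2) that by simp
    show "dim (UNIV :: (real^'n) set) \<le> Suc (CARD('n) - 1)" by simp
    show "(q, q) \<in> dnn_face UNIV B"
      using q(1) by (simp add: K[symmetric] K_def dnn_cone_def)
  qed
  have attained: "\<exists>k z. d_PPS V K (diag L) (a', a') = enat k \<and> k \<le> CARD('n) - 1 \<and>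
      reducing_directions V K (diag L) (a', a') k z \<and> PPS V (reduced_cone K z k) (diag L) (a', a')"
    if same: "(+) a' ` L = (+) a ` L" for a'
  proof -
    obtain k z where kz: "k \<le> CARD('n) - 1" "reducing_directions V K (diag L) (a', a') k z"
        "PPS V (reduced_cone K z k) (diag L) (a', a')"
      using short[OF same] by blast
    from d_PPS_attained[OF kz(2,3)] obtain k' z' where "d_PPS V K (diag L) (a', a') = enat k'" "k' \<le> k"
        "reducing_directions V K (diag L) (a', a') k' z'" "PPS V (reduced_cone K z' k') (diag L) (a', a')"
      by blast
    with kz(1) show ?thesis by (intro exI[of _ k'] exI[of _ z']) simp
  qed
  \<comment> \<open>The base point \<open>a\<close> itself serves to fix \<open>\<kappa>\<close>,
    before \<open>Lh\<close> and \<open>ah\<close> are introduced.\<close>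
  obtain k z where k: "d_PPS V K (diag L) (a, a) = enat k"
    and z: "reducing_directions V K (diag L) (a, a) k z" "PPS V (reduced_cone K z k) (diag L) (a, a)"
    using attained[OF refl] by blast
  obtain \<kappa> where \<kappa>: "\<kappa> > 0"
    "\<And>x e. \<lbrakk>infdist x dnn_cone \<le> e; infdist x ((+) a ` L) \<le> e\<rbrakk>
      \<Longrightarrow> infdist x ((+) a ` L \<inter> dnn_cone) \<le> (\<kappa> * norm x + \<kappa>) * holder_sum e (norm x) k"
    using dnn_error_bound[OF assms(1,4) z[unfolded V_def K_def]] by blast
  show ?thesis
    unfolding V_def[symmetric] K_def[symmetric]
  proof (intro exI[of _ \<kappa>] conjI allI impI)
    show "\<kappa> > 0" by fact
  next
    fix Lh :: "((real^'n^'n) \<times> (real^'n^'n)) set" and ah :: "(real^'n^'n) \<times> (real^'n^'n)"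
    assume hyp: "subspace Lh \<and> Lh \<subseteq> V \<and> ah \<in> V \<and> (+) ah ` Lh = {(x, x) |x. x \<in> (+) a ` L}"
    then obtain a' where a': "ah = (a', a')" "Lh = diag L" "(+) a' ` L = (+) a ` L"
      using diag_translate_eqD[of Lh L ah a] assms(1) by blast
    \<comment> \<open>The degree for \<open>ah\<close> agrees with the one for which
      \<open>\<kappa>\<close> was obtained, since both base points give the same diagonal
      translate.\<close>
    have d_eq: "d_PPS V K Lh ah = enat k"
      using d_PPS_cong[OF diagL, of "(a', a')" "(a, a)" V K] k a' by (simp add: translate_diag)
    show "\<forall>x\<in>sym_mats. \<forall>\<epsilon>::real. infdist x dnn_cone \<le> \<epsilon> \<and> infdist x ((+) a ` L) \<le> \<epsilon> \<longrightarrow>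
        infdist x ((+) a ` L \<inter> dnn_cone) \<le> (\<kappa> * norm x + \<kappa>) *
           (\<epsilon> + (\<Sum>j = 1..the_enat (d_PPS V K Lh ah). \<epsilon> powr (1 / 2 ^ j) * norm x powr (1 - 1 / 2 ^ j)))"
      using \<kappa>(2) unfolding d_eq the_enat.simps holder_sum_def by blast
    obtain k' z' where k': "d_PPS V K (diag L) (a', a') = enat k'" "k' \<le> CARD('n) - 1"
      and z': "reducing_directions V K (diag L) (a', a') k' z'" "PPS V (reduced_cone K z' k') (diag L) (a', a')"
      using attained[OF a'(3)] by blast
    have "d_PPS V K Lh ah \<le> enat (dim (orth_compl V Lh \<inter> orth_compl V {ah}))"
      using d_PPS_le_dim[OF k'(1) z'] k'(1) a' by simp
    moreover have "d_PPS V K Lh ah \<le> enat (CARD('n) - 1)"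
      using k' a' by simp
    moreover have "d_PPS V K Lh ah \<le> d_S V K Lh ah"
    proof (rule d_PPS_le_d_S)
      show "subspace V" unfolding V_def by (simp add: subspace_Times subspace_sym_mats)
      show "convex_cone K" "closed K"
        unfolding K using convex_cone_dnn_face closed_dnn_face B(1) by (blast intro: subspace_UNIV)+
      show "K \<subseteq> V" unfolding K V_def using psd_face_subset_sym by (auto simp: poly_cone_def)
      show "subspace Lh" using hyp by blast
      have "(q, q) \<in> K \<inter> (+) ah ` Lh"
        using q hyp by (auto simp: K_def dnn_cone_def)
      then show "K \<inter> (+) ah ` Lh \<noteq> {}" by blast
    qed
    ultimately show "d_PPS V K Lh ah \<le> Min {enat (CARD('n) - 1),
        enat (dim (orth_compl V Lh \<inter> orth_compl V {ah})), d_S V K Lh ah}"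
      by simp
  qed
qed

end
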